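(* Let $\alpha\in(0,2)$. There exists a $1$-Ahlfors regular curve $E_\alpha\subset\mathbb{H}$ such that the singular integral associated with $K_\alpha$ and $E_\alpha$ is not bounded in $L^2(E_\alpha)$; that is, there is no constant $C>0$ such that the truncated singular integrals $$T_\varepsilon f(p):=\int_{E_\alpha\setminus B(p,\varepsilon)}K_\alpha(p^{-1}\cdot q)\,f(q)\,d\mathcal{H}^1(q)$$ satisfy $\|T_\varepsilon f\|_{L^2(E_\alpha)}\le C\|f\|_{L^2(E_\alpha)}$ for all $f\in L^2(E_\alpha)$ and all $\varepsilon>0$.
   Context: The Heisenberg group $\mathbb{H}$ is $\mathbb{R}^3$ with the group law $(x,y,z)\cdot(x',y',z')=(x+x',\,y+y',\,z+z'+\tfrac12(xy'-yx'))$. It is equipped with the metric $d(p,q)=\|q^{-1}\cdot p\|$, where $\|(x,y,z)\|=((x^2+y^2)^2+z^2)^{1/4}$ is the Koranyi norm. $B(p,r)$ denotes the open ball for $d$ and $\mathcal{H}^1$ the $1$-dimensional Hausdorff measure with respect to $d$; $L^2(E):=L^2(\mathcal{H}^1|_E)$. A Borel set $E\subset\mathbb{H}$ is $1$-Ahlfors regular if there is $C>0$ such that $C^{-1}r\le\mathcal{H}^1(B(p,r)\cap E)\le Cr$ for all $p\in E$ and all $0<r\le\operatorname{diam}(E)$ (with $r<\infty$). A $1$-Ahlfors regular curve is a $1$-Ahlfors regular set which is the image of a (bounded or unbounded) interval of $\mathbb{R}$ under a Lipschitz map into $(\mathbb{H},d)$. For $\alpha>0$ the kernel $K_\alpha:\mathbb{H}\setminus\{0\}\to[0,\infty)$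 is $K_\alpha(x,y,z)=\dfrac{|z|^{\alpha/2}}{\|(x,y,z)\|^{\alpha+1}}$. *)

theory Defs
  imports "HOL-Analysis.Analysis"
begin

section \<open>The Heisenberg group\<close>

datatype heis = Heis (hx: real) (hy: real) (hz: real)

text \<open>The group law is written additively, because \<^class>\<open>group_add\<close> is the library class of
  not necessarily commutative groups: \<open>p + q\<close> stands for \<open>p \<cdot> q\<close>, and \<open>- p\<close> for the inverse of \<open>p\<close>.\<close>

instantiation heis :: group_add
begin

definition zero_heis :: heis where "0 = Heis 0 0 0"

definition plus_heis :: "heis \<Rightarrow> heis \<Rightarrow> heis" where
  "p + q = Heis (hx p + hx q) (hy p + hy q) (hz p + hz q + 1/2 * (hx p * hy q - hy p * hx q))"

definition uminus_heis :: "heis \<Rightarrow> heis" where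
  "- p = Heis (- hx p) (- hy p) (- hz p)"

definition minus_heis :: "heis \<Rightarrow> heis \<Rightarrow> heis" where
  "p - q = p + (- q)" for p q :: heis

instance
  by standard (auto simp: zero_heis_def plus_heis_def uminus_heis_def minus_heis_def algebra_simps)

end

definition koranyi_norm :: "heis \<Rightarrow> real" where
  "koranyi_norm p = root 4 (((hx p)\<^sup>2 + (hy p)\<^sup>2)\<^sup>2 + (hz p)\<^sup>2)"

lemma koranyi_norm_nonneg: "0 \<le> koranyi_norm p"
  by (simp add: koranyi_norm_def)

lemma koranyi_norm_eq_0_iff: "koranyi_norm p = 0 \<longleftrightarrow> p = 0"
  by (cases p)
    (auto simp: koranyi_norm_def zero_heis_def add_nonneg_eq_0_iff sum_power2_eq_zero_iff)

lemma koranyi_norm_uminus: "koranyi_norm (- p) = koranyi_norm p"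
  by (simp add: koranyi_norm_def uminus_heis_def)

lemma koranyi_norm_power2:
  "(koranyi_norm p)\<^sup>2 = cmod (Complex ((hx p)\<^sup>2 + (hy p)\<^sup>2) (hz p))"
proof -
  have "((koranyi_norm p)\<^sup>2)\<^sup>2 = koranyi_norm p ^ 4" by simp
  also have "\<dots> = ((hx p)\<^sup>2 + (hy p)\<^sup>2)\<^sup>2 + (hz p)\<^sup>2" by (simp add: koranyi_norm_def)
  also have "\<dots> = (cmod (Complex ((hx p)\<^sup>2 + (hy p)\<^sup>2) (hz p)))\<^sup>2" by (simp add: cmod_power2)
  finally show ?thesis
    by (rule power2_eq_imp_eq) auto
qed

lemma koranyi_norm_triangle: "koranyi_norm (p + q) \<le> koranyi_norm p + koranyi_norm q"
proof -
  define A where "A r = Complex ((hx r)\<^sup>2 + (hy r)\<^sup>2) (hz r)" for r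
  define a b where "a = sqrt ((hx p)\<^sup>2 + (hy p)\<^sup>2)" and "b = sqrt ((hx q)\<^sup>2 + (hy q)\<^sup>2)"
  define D where "D = Complex (2 * (hx p * hx q + hy p * hy q)) (1/2 * (hx p * hy q - hy p * hx q))"
  have le: "sqrt ((hx r)\<^sup>2 + (hy r)\<^sup>2) \<le> koranyi_norm r" for r
  proof (rule real_le_lsqrt)
    show "0 \<le> koranyi_norm r" by (rule koranyi_norm_nonneg)
    have "Re (A r) \<le> cmod (A r)" by (rule complex_Re_le_cmod)
    then show "(hx r)\<^sup>2 + (hy r)\<^sup>2 \<le> (koranyi_norm r)\<^sup>2"
      by (simp add: koranyi_norm_power2 A_def)
  qed
  have "(cmod D)\<^sup>2 \<le> (2 * (a * b))\<^sup>2"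
  proof -
    have "(2 * (a * b))\<^sup>2 = 4 * (((hx p)\<^sup>2 + (hy p)\<^sup>2) * ((hx q)\<^sup>2 + (hy q)\<^sup>2))"
      by (simp add: a_def b_def power_mult_distrib)
    also have "\<dots> = (cmod D)\<^sup>2 + 15/4 * (hx p * hy q - hy p * hx q)\<^sup>2"
      unfolding D_def cmod_power2 complex.sel by algebra
    finally show ?thesis by simp
  qed
  then have "cmod D \<le> 2 * (a * b)"
    by (rule power2_le_imp_le) (simp add: a_def b_def)
  also have "a * b \<le> koranyi_norm p * koranyi_norm q"
    unfolding a_def b_def by (intro mult_mono le koranyi_norm_nonneg) simp
  finally have D: "cmod D \<le> 2 * (koranyi_norm p * koranyi_norm q)" by simp
  have "A (p + q) = A p + A q + D"
    by (simp add: A_def D_def plus_heis_def complex_eq_iff power2_eq_square algebra_simps)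
  then have "cmod (A (p + q)) \<le> cmod (A p) + cmod (A q) + cmod D"
    by (metis norm_triangle_ineq norm_triangle_mono order_refl)
  with D have "(koranyi_norm (p + q))\<^sup>2 \<le> (koranyi_norm p + koranyi_norm q)\<^sup>2"
    by (simp add: koranyi_norm_power2[folded A_def] power2_sum)
  then show ?thesis
    by (rule power2_le_imp_le) (simp add: koranyi_norm_nonneg)
qed

instantiation heis :: metric_space
begin

definition dist_heis :: "heis \<Rightarrow> heis \<Rightarrow> real" where
  "dist p q = koranyi_norm (- q + p)"

definition uniformity_heis :: "(heis \<times> heis) filter" where
  "uniformity = (INF e\<in>{0 <..}. principal {(p, q). dist (p::heis) q < e})"

definition open_heis :: "heis set \<Rightarrow> bool" where
  "open U \<longleftrightarrow> (\<forall>p\<in>U. eventually (\<lambda>(p', q). p' = p \<longrightarrow> q \<in> U) uniformity)" for U :: "heis set"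

instance
proof
  fix p q r :: heis
  show "dist p q = 0 \<longleftrightarrow> p = q"
    by (metis add.right_neutral add.right_inverse add.assoc dist_heis_def koranyi_norm_eq_0_iff
        left_minus add_0)
  have "- q + p = (- q + r) + (- r + p)" by (simp add: add.assoc)
  then have "dist p q \<le> koranyi_norm (- q + r) + dist p r"
    unfolding dist_heis_def by (metis koranyi_norm_triangle)
  also have "koranyi_norm (- q + r) = dist q r"
    unfolding dist_heis_def by (metis koranyi_norm_uminus minus_add minus_minus)
  finally show "dist p q \<le> dist p r + dist q r" by simp
qed (fact uniformity_heis_def open_heis_def)+

end


section \<open>One-dimensional Hausdorff measure in a metric space\<close>

text \<open>The real-valued \<^const>\<open>diameter\<close> of the library is 0 on unbounded sets, hence an extended
  version.\<close>

definition ediam :: "'a::metric_space set \<Rightarrow> ennreal" where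
  "ediam A = (SUP x\<in>A. SUP y\<in>A. ennreal (dist x y))"

definition hausdorff1_pre :: "real \<Rightarrow> 'a::metric_space set \<Rightarrow> ennreal" where
  "hausdorff1_pre \<delta> A =
    (INF U\<in>{U :: nat \<Rightarrow> 'a set. A \<subseteq> (\<Union>n. U n) \<and> (\<forall>n. ediam (U n) \<le> ennreal \<delta>)}. \<Sum>n. ediam (U n))"

definition hausdorff1_outer :: "'a::metric_space set \<Rightarrow> ennreal" where
  "hausdorff1_outer A = (SUP \<delta>\<in>{0<..}. hausdorff1_pre \<delta> A)"

definition hausdorff1 :: "'a::metric_space measure" where
  "hausdorff1 = measure_of UNIV (sets borel) hausdorff1_outer"

lemma space_hausdorff1 [simp]: "space hausdorff1 = UNIV"
  by (simp add: hausdorff1_def space_measure_of_conv)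

lemma sets_hausdorff1 [simp, measurable_cong]: "sets hausdorff1 = sets borel"
  unfolding hausdorff1_def by (metis sets.sigma_sets_eq sets_measure_of space_borel top_greatest Pow_UNIV)

text \<open>Since \<^const>\<open>measure_of\<close> yields the zero measure unless the given set function is a measure,
  the rest of this section shows that the outer measure is one on Borel sets, so that the two agree
  there.\<close>

lemma ediam_mono: "A \<subseteq> B \<Longrightarrow> ediam A \<le> ediam B"
  unfolding ediam_def by (intro SUP_mono) (meson SUP_subset_mono order_refl subsetD)

lemma ediam_empty [simp]: "ediam {} = 0"
  by (simp add: ediam_def bot_ennreal)

lemma dist_le_ediam: "x \<in> A \<Longrightarrow> y \<in> A \<Longrightarrow> ennreal (dist x y) \<le> ediam A"
  unfolding ediam_def by (meson SUP_upper2 SUP_upper)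

lemma hausdorff1_pre_le:
  "A \<subseteq> (\<Union>n. U n) \<Longrightarrow> (\<And>n. ediam (U n) \<le> ennreal \<delta>) \<Longrightarrow> hausdorff1_pre \<delta> A \<le> (\<Sum>n. ediam (U n))"
  unfolding hausdorff1_pre_def by (rule INF_lower) auto

lemma hausdorff1_pre_mono: "A \<subseteq> B \<Longrightarrow> hausdorff1_pre \<delta> A \<le> hausdorff1_pre \<delta> B"
  unfolding hausdorff1_pre_def by (rule INF_superset_mono) auto

lemma hausdorff1_pre_antimono: "\<delta> \<le> \<eta> \<Longrightarrow> hausdorff1_pre \<eta> A \<le> hausdorff1_pre \<delta> A"
  unfolding hausdorff1_pre_def
  by (rule INF_superset_mono) (auto intro: order_trans ennreal_leI)

lemma hausdorff1_pre_le_outer: "0 < \<delta> \<Longrightarrow> hausdorff1_pre \<delta> A \<le> hausdorff1_outer A"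
  unfolding hausdorff1_outer_def by (rule SUP_upper) auto

lemma hausdorff1_outer_mono: "A \<subseteq> B \<Longrightarrow> hausdorff1_outer A \<le> hausdorff1_outer B"
  unfolding hausdorff1_outer_def by (rule SUP_mono) (auto intro: hausdorff1_pre_mono)

lemma hausdorff1_outer_empty [simp]: "hausdorff1_outer {} = 0"
proof -
  have "hausdorff1_pre \<delta> ({} :: 'a set) = 0" if "0 < \<delta>" for \<delta>
    using hausdorff1_pre_le[of "{} :: 'a set" "\<lambda>_. {}" \<delta>] by simp
  then show ?thesis by (simp add: hausdorff1_outer_def)
qed

lemma hausdorff1_pre_UN: "hausdorff1_pre \<delta> (\<Union>i. A i) \<le> (\<Sum>i. hausdorff1_pre \<delta> (A i))"
proof (rule ennreal_le_epsilon)
  fix e :: real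
  assume fin: "(\<Sum>i. hausdorff1_pre \<delta> (A i)) < top" and e: "0 < e"
  have "\<exists>U. A i \<subseteq> (\<Union>n. U n) \<and> (\<forall>n. ediam (U n) \<le> ennreal \<delta>)
      \<and> (\<Sum>n. ediam (U n)) \<le> hausdorff1_pre \<delta> (A i) + ennreal (e * (1/2) ^ Suc i)" for i
  proof -
    have "hausdorff1_pre \<delta> (A i) < hausdorff1_pre \<delta> (A i) + ennreal (e * (1/2) ^ Suc i)"
    proof -
      have "hausdorff1_pre \<delta> (A i) \<noteq> top"
        using ennreal_suminf_lessD[OF fin, of i] by simp
      then show ?thesis
        using e by (simp add: ennreal_add_left_cancel_less[of _ 0, simplified])
    qed
    then show ?thesis
      unfolding hausdorff1_pre_def INF_less_iff by (auto intro: less_imp_le)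
  qed
  then obtain U where U: "\<And>i. A i \<subseteq> (\<Union>n. U i n)" "\<And>i n. ediam (U i n) \<le> ennreal \<delta>"
    and le: "\<And>i. (\<Sum>n. ediam (U i n)) \<le> hausdorff1_pre \<delta> (A i) + ennreal (e * (1/2) ^ Suc i)"
    by metis
  define V where "V k = (case prod_decode k of (i, n) \<Rightarrow> U i n)" for k
  have V: "V (prod_encode (i, n)) = U i n" for i n by (simp add: V_def)
  have "(\<Union>i. A i) \<subseteq> (\<Union>k. V k)"
  proof
    fix x assume "x \<in> (\<Union>i. A i)"
    then obtain i n where "x \<in> U i n" using U(1) by blast
    then show "x \<in> (\<Union>k. V k)" using V by blast
  qed
  moreover have "ediam (V k) \<le> ennreal \<delta>" for k
    by (simp add: V_def U(2) split: prod.split)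
  ultimately have "hausdorff1_pre \<delta> (\<Union>i. A i) \<le> (\<Sum>k. ediam (V k))"
    by (rule hausdorff1_pre_le)
  also have "\<dots> = (\<Sum>i. \<Sum>n. ediam (U i n))"
    using suminf_ennreal_2dimen[of "\<lambda>i. \<Sum>n. ediam (U i n)" "\<lambda>(i, n). ediam (U i n)"]
    by (simp add: V_def comp_def split_def)
  also have "\<dots> \<le> (\<Sum>i. hausdorff1_pre \<delta> (A i) + ennreal (e * (1/2) ^ Suc i))"
    by (intro suminf_le le) auto
  also have "\<dots> = (\<Sum>i. hausdorff1_pre \<delta> (A i)) + (\<Sum>i. ennreal (e * (1/2) ^ Suc i))"
    by (rule suminf_add[symmetric]) auto
  also have "(\<Sum>i. ennreal (e * (1/2) ^ Suc i)) = ennreal e"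
    using e sums_mult[OF power_half_series, of e] by (intro suminf_ennreal_eq) auto
  finally show "hausdorff1_pre \<delta> (\<Union>i. A i) \<le> (\<Sum>i. hausdorff1_pre \<delta> (A i)) + ennreal e" .
qed

lemma hausdorff1_outer_UN: "hausdorff1_outer (\<Union>i. A i) \<le> (\<Sum>i. hausdorff1_outer (A i))"
proof -
  have "hausdorff1_pre \<delta> (\<Union>i. A i) \<le> (\<Sum>i. hausdorff1_outer (A i))" if "0 < \<delta>" for \<delta>
    using hausdorff1_pre_UN
    by (rule order_trans) (intro suminf_le hausdorff1_pre_le_outer that; auto)
  then show ?thesis
    unfolding hausdorff1_outer_def[of "\<Union>i. A i"] by (intro SUP_least) auto
qed

lemma hausdorff1_outer_Un: "hausdorff1_outer (A \<union> B) \<le> hausdorff1_outer A + hausdorff1_outer B"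
  using hausdorff1_outer_UN[of "binaryset A B"]
  by (simp add: UN_binaryset_eq suminf_binaryset_eq[unfolded comp_def])

lemma hausdorff1_outer_separated:
  fixes A B :: "'a::metric_space set"
  assumes e: "0 < e" and sep: "\<And>x y. x \<in> A \<Longrightarrow> y \<in> B \<Longrightarrow> e \<le> dist x y"
  shows "hausdorff1_outer A + hausdorff1_outer B \<le> hausdorff1_outer (A \<union> B)"
proof -
  have pre: "hausdorff1_pre \<delta> A + hausdorff1_pre \<delta> B \<le> hausdorff1_pre \<delta> (A \<union> B)"
    if \<delta>: "0 < \<delta>" "\<delta> < e" for \<delta>
    unfolding hausdorff1_pre_def[of \<delta> "A \<union> B"]
  proof (rule INF_greatest)
    fix U :: "nat \<Rightarrow> 'a set" assume "U \<in> {U. A \<union> B \<subseteq> (\<Union>n. U n) \<and> (\<forall>n. ediam (U n) \<le> ennreal \<delta>)}"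
    then have U: "A \<union> B \<subseteq> (\<Union>n. U n)" "\<And>n. ediam (U n) \<le> ennreal \<delta>" by auto
    define V where "V n = (if U n \<inter> A = {} then {} else U n)" for n
    define W where "W n = (if U n \<inter> A = {} then U n else {})" for n
    have disj: "U n \<inter> A = {}" if "y \<in> U n" "y \<in> B" for n y
    proof (rule ccontr)
      assume "U n \<inter> A \<noteq> {}"
      then obtain x where x: "x \<in> U n" "x \<in> A" by auto
      have "ennreal (dist x y) \<le> ennreal \<delta>"
        using dist_le_ediam[OF x(1) that(1)] U(2) by (rule order_trans)
      then show False using sep[OF x(2) that(2)] \<delta> by simp
    qed
    have "hausdorff1_pre \<delta> A \<le> (\<Sum>n. ediam (V n))"
      using U by (intro hausdorff1_pre_le) (force simp: V_def)+
    moreover have "hausdorff1_pre \<delta> B \<le> (\<Sum>n. ediam (W n))"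
    proof (rule hausdorff1_pre_le)
      show "B \<subseteq> (\<Union>n. W n)"
      proof
        fix y assume y: "y \<in> B"
        then obtain n where "y \<in> U n" using U(1) by blast
        then have "y \<in> W n" using disj y by (auto simp: W_def)
        then show "y \<in> (\<Union>n. W n)" by blast
      qed
    qed (use U in \<open>auto simp: W_def\<close>)
    ultimately have "hausdorff1_pre \<delta> A + hausdorff1_pre \<delta> B
        \<le> (\<Sum>n. ediam (V n)) + (\<Sum>n. ediam (W n))" by (rule add_mono)
    also have "\<dots> = (\<Sum>n. ediam (V n) + ediam (W n))" by (rule suminf_add) auto
    also have "\<dots> = (\<Sum>n. ediam (U n))"
      by (rule suminf_cong) (simp add: V_def W_def)
    finally show "hausdorff1_pre \<delta> A + hausdorff1_pre \<delta> B \<le> (\<Sum>n. ediam (U n))" .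
  qed
  have le: "hausdorff1_pre \<delta> A + hausdorff1_pre \<eta> B \<le> hausdorff1_outer (A \<union> B)"
    if "0 < \<delta>" "0 < \<eta>" for \<delta> \<eta>
  proof -
    define m where "m = min (min \<delta> \<eta>) (e / 2)"
    have m: "0 < m" "m < e" "m \<le> \<delta>" "m \<le> \<eta>" using that e by (auto simp: m_def)
    have "hausdorff1_pre \<delta> A + hausdorff1_pre \<eta> B \<le> hausdorff1_pre m A + hausdorff1_pre m B"
      by (intro add_mono hausdorff1_pre_antimono m)
    also have "\<dots> \<le> hausdorff1_pre m (A \<union> B)" by (rule pre) fact+
    also have "\<dots> \<le> hausdorff1_outer (A \<union> B)" by (rule hausdorff1_pre_le_outer) fact
    finally show ?thesis .
  qed
  have ne: "{0::real<..} \<noteq> {}" by (simp add: greaterThan_non_empty)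
  have "hausdorff1_pre \<delta> A + hausdorff1_outer B \<le> hausdorff1_outer (A \<union> B)" if "0 < \<delta>" for \<delta>
  proof -
    have "(SUP \<eta>\<in>{0<..}. hausdorff1_pre \<delta> A + hausdorff1_pre \<eta> B) \<le> hausdorff1_outer (A \<union> B)"
      by (rule SUP_least) (use that in \<open>auto intro: le\<close>)
    then show ?thesis
      by (simp only: hausdorff1_outer_def[of B] ennreal_SUP_add_right[OF ne])
  qed
  then have "(SUP \<delta>\<in>{0<..}. hausdorff1_pre \<delta> A + hausdorff1_outer B) \<le> hausdorff1_outer (A \<union> B)"
    by (intro SUP_least) auto
  then show ?thesis
    by (simp only: hausdorff1_outer_def[of A] ennreal_SUP_add_left[OF ne])
qed

lemma hausdorff1_outer_layers:
  fixes X :: "nat \<Rightarrow> 'a::metric_space set" and f :: "'a \<Rightarrow> real"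
  assumes lip: "\<And>x y. \<bar>f x - f y\<bar> \<le> dist x y"
    and gap: "\<And>k. 0 < e k"
    and sep: "\<And>j k x y. j < k \<Longrightarrow> x \<in> X j \<Longrightarrow> y \<in> X k \<Longrightarrow> f y + e j \<le> f x"
    and sub: "\<And>k. X k \<subseteq> Y"
  shows "(\<Sum>k. hausdorff1_outer (X k)) \<le> hausdorff1_outer Y"
proof (rule suminf_le_const)
  fix n
  have "(\<Sum>k<n. hausdorff1_outer (X k)) \<le> hausdorff1_outer (\<Union>k<n. X k)"
  proof (induction n)
    case (Suc n)
    define m where "m = Min (insert 1 (e ` {..<n}))"
    have m: "0 < m" "\<And>k. k < n \<Longrightarrow> m \<le> e k"
      using gap by (auto simp: m_def)
    have "(\<Sum>k<Suc n. hausdorff1_outer (X k))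
        \<le> hausdorff1_outer (\<Union>k<n. X k) + hausdorff1_outer (X n)"
      using Suc by (simp add: add_right_mono)
    also have "\<dots> \<le> hausdorff1_outer ((\<Union>k<n. X k) \<union> X n)"
    proof (rule hausdorff1_outer_separated[OF m(1)])
      fix x y assume "x \<in> (\<Union>k<n. X k)" "y \<in> X n"
      then obtain k where "k < n" "x \<in> X k" by auto
      then show "m \<le> dist x y"
        using sep[OF _ _ \<open>y \<in> X n\<close>, of k x] m(2)[of k] lip[of x y] by linarith
    qed
    also have "(\<Union>k<n. X k) \<union> X n = (\<Union>k<Suc n. X k)" by (auto simp: less_Suc_eq)
    finally show ?case .
  qed simp
  also have "\<dots> \<le> hausdorff1_outer Y"
    using sub by (intro hausdorff1_outer_mono) auto
  finally show "(\<Sum>k<n. hausdorff1_outer (X k)) \<le> hausdorff1_outer Y" .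
qed simp

lemma closed_in_lambda_system_hausdorff1_outer:
  fixes F :: "'a::metric_space set"
  assumes F: "closed F"
  shows "F \<in> lambda_system UNIV UNIV hausdorff1_outer"
proof (cases "F = {}")
  case True
  then show ?thesis by (simp add: lambda_system_def)
next
  case False
  have le: "hausdorff1_outer (X \<inter> F) + hausdorff1_outer (X - F) \<le> hausdorff1_outer X" for X
  proof (cases "hausdorff1_outer X = top")
    case False
    define f where "f x = infdist x F" for x
    have lip: "\<bar>f x - f y\<bar> \<le> dist x y" for x y
      using infdist_triangle[of x F y] infdist_triangle[of y F x]
      by (simp add: f_def dist_commute abs_le_iff)
    have f0: "f x = 0 \<longleftrightarrow> x \<in> F" "0 \<le> f x" for x
      using in_closed_iff_infdist_zero[OF F \<open>F \<noteq> {}\<close>] by (auto simp: f_def infdist_nonneg)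
    define R where "R k = {x \<in> X. inverse (real (k + 2)) < f x \<and> f x \<le> inverse (real (k + 1))}" for k
    define X' where "X' n = {x \<in> X. inverse (real (n + 1)) < f x}" for n
    have tail: "X - F \<subseteq> X' n \<union> (\<Union>k. R (k + n))" for n
    proof
      fix x assume "x \<in> X - F"
      then have x: "x \<in> X" "0 < f x" using f0[of x] by auto
      show "x \<in> X' n \<union> (\<Union>k. R (k + n))"
      proof (cases "x \<in> X' n")
        case False
        obtain N where N: "inverse (real (Suc N)) < f x" using reals_Archimedean[OF x(2)] by auto
        define m where "m = (LEAST m. inverse (real (m + 1)) < f x)"
        have m: "inverse (real (m + 1)) < f x" and min: "\<And>k. k < m \<Longrightarrow> f x \<le> inverse (real (k + 1))"
          using LeastI[of "\<lambda>m. inverse (real (m + 1)) < f x" N] N not_less_Least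
          by (auto simp: m_def not_less[symmetric])
        have "n < m"
        proof (rule ccontr)
          assume "\<not> n < m"
          then have "inverse (real (n + 1)) \<le> inverse (real (m + 1))" by (simp add: le_imp_inverse_le)
          moreover have "\<not> inverse (real (n + 1)) < f x" using False x by (simp add: X'_def)
          moreover note m
          ultimately show False by linarith
        qed
        then have "x \<in> R (m - 1)" "m - 1 = (m - 1 - n) + n"
          using m min[of "m - 1"] x by (auto simp: R_def)
        then show ?thesis by (metis UN_I UNIV_I UnI2)
      qed simp
    qed
    have half: "(\<Sum>k. hausdorff1_outer (R (2 * k + i))) \<le> hausdorff1_outer X" for i
    proof (rule hausdorff1_outer_layers[where f = f
          and e = "\<lambda>k. inverse (real (2 * k + i + 2)) - inverse (real (2 * k + i + 3))"])
      fix j k :: nat and x y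
      assume jk: "j < k" and x: "x \<in> R (2 * j + i)" and y: "y \<in> R (2 * k + i)"
      have "inverse (real (2 * k + i + 1)) \<le> inverse (real (2 * j + i + 3))"
        using jk by (intro le_imp_inverse_le) auto
      then show "f y + (inverse (real (2 * j + i + 2)) - inverse (real (2 * j + i + 3))) \<le> f x"
        using x y unfolding R_def mem_Collect_eq by linarith
    next
      fix k :: nat
      show "0 < inverse (real (2 * k + i + 2)) - inverse (real (2 * k + i + 3))" by simp
    qed (auto simp: R_def lip)
    define r where "r k = hausdorff1_outer (R k)" for k
    have "(\<Sum>k. r k) = (\<Sum>k. r (2 * k)) + (\<Sum>k. r (2 * k + 1))"
    proof -
      have "(\<lambda>k. \<Sum>i\<in>{k*2..<k*2+2}. r i) sums (\<Sum>k. r k)"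
        by (rule sums_group) auto
      moreover have "(\<Sum>i\<in>{k*2..<k*2+2}. r i) = r (2 * k) + r (2 * k + 1)" for k
        by (simp add: mult.commute numeral_2_eq_2)
      ultimately have "(\<Sum>k. r k) = (\<Sum>k. r (2 * k) + r (2 * k + 1))" by (simp add: sums_iff)
      also have "\<dots> = (\<Sum>k. r (2 * k)) + (\<Sum>k. r (2 * k + 1))" by (rule suminf_add[symmetric]) auto
      finally show ?thesis .
    qed
    also have "\<dots> \<le> hausdorff1_outer X + hausdorff1_outer X"
      using half[of 0] half[of 1] by (intro add_mono) (auto simp: r_def)
    also have "\<dots> < top" using False by (simp add: less_top)
    finally have fin: "(\<Sum>k. r k) < top" .
    have tail0: "(\<lambda>n. \<Sum>k. r (k + n)) \<longlonglongrightarrow> 0"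
    proof -
      have rfin: "r k < top" for k using ennreal_suminf_lessD[OF fin] .
      define s where "s k = enn2real (r k)" for k
      have s: "r k = ennreal (s k)" "0 \<le> s k" for k using rfin by (auto simp: s_def)
      have sum: "summable s"
        using fin s by (intro summable_suminf_not_top) (auto simp: less_top)
      have "(\<lambda>n. \<Sum>k. s (k + n)) \<longlonglongrightarrow> 0"
        by (rule suminf_exist_split2[OF sum])
      then have "(\<lambda>n. ennreal (\<Sum>k. s (k + n))) \<longlonglongrightarrow> ennreal 0"
        by (rule tendsto_ennrealI)
      moreover have "ennreal (\<Sum>k. s (k + n)) = (\<Sum>k. r (k + n))" for n
        using s sum by (simp add: suminf_ennreal2 summable_iff_shift)
      ultimately show ?thesis by simp
    qed
    have bd: "hausdorff1_outer (X \<inter> F) + hausdorff1_outer (X - F)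
        \<le> hausdorff1_outer X + (\<Sum>k. r (k + n))" for n
    proof -
      have "hausdorff1_outer (X - F) \<le> hausdorff1_outer (X' n \<union> (\<Union>k. R (k + n)))"
        by (rule hausdorff1_outer_mono[OF tail])
      also have "\<dots> \<le> hausdorff1_outer (X' n) + hausdorff1_outer (\<Union>k. R (k + n))"
        by (rule hausdorff1_outer_Un)
      also have "\<dots> \<le> hausdorff1_outer (X' n) + (\<Sum>k. r (k + n))"
        unfolding r_def by (intro add_left_mono hausdorff1_outer_UN)
      finally have "hausdorff1_outer (X \<inter> F) + hausdorff1_outer (X - F)
          \<le> (hausdorff1_outer (X \<inter> F) + hausdorff1_outer (X' n)) + (\<Sum>k. r (k + n))"
        by (simp add: add.assoc add_left_mono)
      also have "hausdorff1_outer (X \<inter> F) + hausdorff1_outer (X' n) \<le> hausdorff1_outer ((X \<inter> F) \<union> X' n)"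
      proof (rule hausdorff1_outer_separated[of "inverse (real (n + 1))"])
        fix x y assume "x \<in> X \<inter> F" "y \<in> X' n"
        then show "inverse (real (n + 1)) \<le> dist x y"
          using lip[of x y] f0(1)[of x] by (auto simp: X'_def)
      qed simp
      also have "\<dots> \<le> hausdorff1_outer X"
        by (rule hausdorff1_outer_mono) (auto simp: X'_def)
      finally show ?thesis by (simp add: add_right_mono)
    qed
    have "(\<lambda>n. hausdorff1_outer X + (\<Sum>k. r (k + n))) \<longlonglongrightarrow> hausdorff1_outer X + 0"
      by (intro tendsto_add tendsto_const tail0)
    then show ?thesis
      using bd by (intro LIMSEQ_le_const) auto
  qed simp
  show ?thesis
    unfolding lambda_system_def
  proof (intro CollectI conjI ballI UNIV_I antisym)
    fix X :: "'a set"
    show "hausdorff1_outer (F \<inter> X) + hausdorff1_outer ((UNIV - F) \<inter> X) \<le> hausdorff1_outer X"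
      using le[of X] by (simp add: Int_commute Diff_eq)
    have "X = (F \<inter> X) \<union> ((UNIV - F) \<inter> X)" by auto
    then show "hausdorff1_outer X \<le> hausdorff1_outer (F \<inter> X) + hausdorff1_outer ((UNIV - F) \<inter> X)"
      using hausdorff1_outer_Un by metis
  qed
qed

lemma emeasure_hausdorff1:
  fixes A :: "'a::metric_space set"
  assumes A: "A \<in> sets borel"
  shows "emeasure hausdorff1 A = hausdorff1_outer A"
proof -
  let ?L = "lambda_system UNIV UNIV (hausdorff1_outer :: 'a set \<Rightarrow> ennreal)"
  have "outer_measure_space (Pow UNIV) (hausdorff1_outer :: 'a set \<Rightarrow> ennreal)"
    unfolding outer_measure_space_def positive_def increasing_def countably_subadditive_def
    by (auto intro: hausdorff1_outer_mono hausdorff1_outer_UN)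
  from sigma_algebra.caratheodory_lemma[OF sigma_algebra_Pow this]
  have L: "measure_space UNIV ?L hausdorff1_outer" by simp
  have sub: "sets borel \<subseteq> ?L"
  proof -
    have "sigma_algebra UNIV ?L" using L by (simp add: measure_space_def)
    then have "sigma_sets UNIV (Collect closed) \<subseteq> ?L"
      by (rule sigma_algebra.sigma_sets_subset) (auto intro: closed_in_lambda_system_hausdorff1_outer)
    then show ?thesis by (simp add: borel_eq_closed)
  qed
  have "countably_additive (sets borel) (hausdorff1_outer :: 'a set \<Rightarrow> ennreal)"
    using L sub unfolding measure_space_def countably_additive_def by blast
  moreover have "positive (sets borel) (hausdorff1_outer :: 'a set \<Rightarrow> ennreal)"
    by (simp add: positive_def)
  ultimately show ?thesis
    using A by (intro emeasure_measure_of[OF hausdorff1_def]) auto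
qed


section \<open>Ahlfors regular curves\<close>

definition ahlfors_regular1 :: "'a::metric_space set \<Rightarrow> bool" where
  "ahlfors_regular1 E \<longleftrightarrow> E \<in> sets borel \<and>
    (\<exists>C>0. \<forall>p\<in>E. \<forall>r>0. ennreal r \<le> ediam E \<longrightarrow>
      ennreal (inverse C * r) \<le> emeasure hausdorff1 (ball p r \<inter> E) \<and>
      emeasure hausdorff1 (ball p r \<inter> E) \<le> ennreal (C * r))"

definition ahlfors_regular1_curve :: "'a::metric_space set \<Rightarrow> bool" where
  "ahlfors_regular1_curve E \<longleftrightarrow> ahlfors_regular1 E \<and>
    (\<exists>(I :: real set) \<gamma> L. is_interval I \<and> L-lipschitz_on I \<gamma> \<and> E = \<gamma> ` I)"


section \<open>Truncated singular integrals\<close>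

text \<open>The \<open>L\<^sup>2\<close> norm is extended real valued, being \<open>\<infinity>\<close> for functions that are not square
  integrable.\<close>

definition L2_enorm :: "'a::metric_space set \<Rightarrow> ('a \<Rightarrow> real) \<Rightarrow> ennreal" where
  "L2_enorm E f =
    (let I = \<integral>\<^sup>+ p. ennreal ((f p)\<^sup>2) \<partial>restrict_space hausdorff1 E
     in if I = \<infinity> then \<infinity> else ennreal (sqrt (enn2real I)))"

definition L2 :: "'a::metric_space set \<Rightarrow> ('a \<Rightarrow> real) set" where
  "L2 E = {f \<in> borel_measurable (restrict_space hausdorff1 E). L2_enorm E f < \<infinity>}"

definition heis_kernel :: "real \<Rightarrow> heis \<Rightarrow> real" where
  "heis_kernel \<alpha> p = \<bar>hz p\<bar> powr (\<alpha> / 2) / koranyi_norm p powr (\<alpha> + 1)"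

text \<open>For a 1-Ahlfors regular \<open>E\<close>, \<open>f \<in> L2 E\<close> and a kernel with \<open>\<bar>K p\<bar> \<le> 1 / koranyi_norm p\<close>, such as
  \<^const>\<open>heis_kernel\<close>, the integral below converges absolutely by the Cauchy-Schwarz inequality, so
  the default value 0 of the Bochner integral plays no role.\<close>

definition truncated_SIO :: "(heis \<Rightarrow> real) \<Rightarrow> heis set \<Rightarrow> real \<Rightarrow> (heis \<Rightarrow> real) \<Rightarrow> heis \<Rightarrow> real" where
  "truncated_SIO K E \<epsilon> f p = (LINT q:(E - ball p \<epsilon>)|hausdorff1. K (- p + q) * f q)"

definition SIO_bounded_L2 :: "(heis \<Rightarrow> real) \<Rightarrow> heis set \<Rightarrow> bool" where
  "SIO_bounded_L2 K E \<longleftrightarrow>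
    (\<exists>C>0. \<forall>f\<in>L2 E. \<forall>\<epsilon>>0. L2_enorm E (truncated_SIO K E \<epsilon> f) \<le> ennreal C * L2_enorm E f)"

end

theory Submission
  imports Defs
begin

text \<open>Lift the graph of a Lipschitz function \<open>f\<close> on the line horizontally to the Heisenberg group:
  \<open>\<gamma> t = (t, f t, t * f t / 2 - F t)\<close> with \<open>F\<close> an antiderivative of \<open>f\<close>. The height of
  \<open>- \<gamma> s + \<gamma> t\<close> is the error \<open>A s t\<close> of the trapezoid rule for \<open>f\<close> on \<open>{s..t}\<close>. If \<open>f\<close> is Lipschitz and
  \<open>A s t\<close> is of order \<open>(t - s)\<^sup>2\<close>, then \<open>\<gamma>\<close> is Lipschitz with the 1-Lipschitz left inverse \<^const>\<open>hx\<close>, so its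
  range is an Ahlfors regular curve on which Hausdorff measure is comparable to \<open>dt\<close>
  (\<open>ahlfors_regular_curve\<close>, \<open>nn_integral_curve_ge\<close>).

  On this curve the kernel at \<open>(s, s + h)\<close> is comparable to \<open>(\<bar>A s (s + h)\<bar> / h\<^sup>2) powr (\<alpha> / 2) / h\<close>. If the
  graph has bumps of slope \<open>\<theta> k\<close> at a sequence of scales \<open>1 / freq k\<close>, then \<open>\<bar>A s (s + h)\<bar> / h\<^sup>2\<close> is of size
  \<open>\<theta> k\<close> for \<open>h\<close> about \<open>1 / freq k\<close>, so the truncated integrals of the indicator of an arc grow like the
  partial sums of \<open>\<theta> k powr (\<alpha> / 2)\<close>. The function stays Lipschitz if \<open>\<theta>\<close> is summable. For \<open>\<alpha> < 2\<close> both
  demands are compatible: take \<open>\<theta> k = (k + 1) powr (- 2 / \<alpha>)\<close>. Since the kernel is nonnegative,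
  this divergence rules out an \<open>L\<^sup>2\<close> bound (\<open>not_SIO_bounded_L2_if_diverges\<close>).

  Bumps are realised by a lacunary series \<open>\<Sum>k. \<theta> k / freq k * cos (2 * pi * freq k * x)\<close>, with \<open>F\<close> the series
  of termwise antiderivatives. The trapezoid error acts diagonally on cosines
  (\<open>trapezoid_error_cos\<close>), which makes the contribution of each frequency explicit; when the
  frequencies grow fast enough, the one matching the scale dominates all others together
  (\<open>trapezoid_error_ge\<close>). The remaining factor \<open>\<bar>cos (pi * freq k * (s + t))\<bar>\<close> may vanish, but integrating over
  \<open>h \<in> {1 / (2 * freq k)..1 / freq k}\<close> averages it over half a period, and so the lower bound holds at
  every base point \<open>s\<close>.\<close>

section \<open>Hausdorff measure and Lipschitz maps\<close>

text \<open>Cutting the interval into equal pieces gives covers of the image by arcs of arbitrarily small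
  diameter whose diameters sum to the Lipschitz bound on the total length.\<close>

lemma hausdorff1_outer_lipschitz_image_le:
  fixes \<gamma> :: "real \<Rightarrow> 'a::metric_space"
  assumes lip: "L-lipschitz_on {a..b} \<gamma>" and "a \<le> b"
  shows "hausdorff1_outer (\<gamma> ` {a..b}) \<le> ennreal (L * (b - a))"
  unfolding hausdorff1_outer_def
proof (rule SUP_least)
  fix \<delta> :: real assume "\<delta> \<in> {0<..}"
  then have \<delta>: "0 < \<delta>" by simp
  have L: "0 \<le> L" using lip by (rule lipschitz_on_nonneg)
  define D where "D = L * (b - a)"
  have D: "0 \<le> D" using L \<open>a \<le> b\<close> by (simp add: D_def)
  obtain N0 :: nat where N0: "D / \<delta> < real N0" using reals_Archimedean2 by blast
  define N where "N = Suc N0"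
  have N: "0 < N" "D / real N \<le> \<delta>"
  proof -
    have "D / \<delta> \<le> real N" using N0 by (simp add: N_def)
    then show "D / real N \<le> \<delta>" using \<delta> by (simp add: field_simps N_def)
  qed (simp add: N_def)
  define J where "J n = {a + real n * ((b - a) / real N) .. a + real (Suc n) * ((b - a) / real N)}" for n
  define U where "U n = (if n < N then \<gamma> ` (J n \<inter> {a..b}) else {})" for n
  have U: "ediam (U n) \<le> ennreal (if n < N then D / real N else 0)" for n
  proof (cases "n < N")
    case True
    have "dist (\<gamma> x) (\<gamma> y) \<le> D / real N" if "x \<in> J n \<inter> {a..b}" "y \<in> J n \<inter> {a..b}" for x y
    proof -
      have "dist x y \<le> (b - a) / real N"
        using that unfolding J_def dist_real_def of_nat_Suc distrib_right mult_1_left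
        by (auto simp only: Int_iff atLeastAtMost_iff abs_le_iff)
      then have "L * dist x y \<le> L * ((b - a) / real N)" using L by (rule mult_left_mono)
      then show ?thesis
        using lipschitz_onD[OF lip, of x y] that by (simp add: D_def)
    qed
    then show ?thesis
      unfolding ediam_def using True by (auto simp: U_def intro!: SUP_least ennreal_leI)
  qed (simp add: U_def)
  have "\<gamma> ` {a..b} \<subseteq> (\<Union>n. U n)"
  proof clarify
    fix x assume x: "x \<in> {a..b}"
    define w where "w = (b - a) / real N"
    have w: "0 \<le> w" "a + real N * w = b" using N \<open>a \<le> b\<close> by (simp_all add: w_def)
    define m where "m = (LEAST m. x \<le> a + real (Suc m) * w)"
    have m: "x \<le> a + real (Suc m) * w" "m < N"
      and min: "\<And>k. k < m \<Longrightarrow> a + real (Suc k) * w < x"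
    proof -
      have N': "x \<le> a + real (Suc (N - 1)) * w" using w N x by simp
      then show "x \<le> a + real (Suc m) * w" unfolding m_def by (rule LeastI)
      have "m \<le> N - 1" unfolding m_def using N' by (rule Least_le)
      then show "m < N" using N by simp
      show "a + real (Suc k) * w < x" if "k < m" for k
        using not_less_Least[OF that[unfolded m_def]] by simp
    qed
    have "a + real m * w \<le> x"
    proof (cases m)
      case 0
      then show ?thesis using x by simp
    next
      case (Suc k)
      then show ?thesis using min[of k] by simp
    qed
    then have "x \<in> J m" using m by (simp add: J_def w_def)
    then have "\<exists>n<N. x \<in> J n" using m by auto
    then show "\<gamma> x \<in> (\<Union>n. U n)" using x by (auto simp: U_def)
  qed
  moreover have "ediam (U n) \<le> ennreal \<delta>" for n
    using order_trans[OF U ennreal_leI] N \<delta> by (metis less_imp_le)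
  ultimately have "hausdorff1_pre \<delta> (\<gamma> ` {a..b}) \<le> (\<Sum>n. ediam (U n))"
    by (rule hausdorff1_pre_le)
  also have "\<dots> \<le> (\<Sum>n. ennreal (if n < N then D / real N else 0))"
    by (intro suminf_le U) auto
  also have "\<dots> = (\<Sum>n<N. ennreal (if n < N then D / real N else 0))"
    by (rule suminf_finite) auto
  also have "\<dots> = ennreal (\<Sum>n<N. D / real N)"
    using D by (subst sum_ennreal[symmetric]) auto
  also have "(\<Sum>n<N. D / real N) = D" using N by simp
  finally show "hausdorff1_pre \<delta> (\<gamma> ` {a..b}) \<le> ennreal (L * (b - a))" by (simp add: D_def)
qed

text \<open>A 1-Lipschitz function to the line maps every covering set into an interval no longer than its
  diameter. The set \<open>S\<close> stands in for the image of \<open>X\<close>, which may fail to be measurable.\<close>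

lemma emeasure_lborel_le_hausdorff1_outer:
  fixes f :: "'a::metric_space \<Rightarrow> real"
  assumes lip: "\<And>x y. \<bar>f x - f y\<bar> \<le> dist x y"
    and S: "S \<in> sets borel" "S \<subseteq> f ` X"
  shows "emeasure lborel S \<le> hausdorff1_outer X"
proof -
  have "emeasure lborel S \<le> hausdorff1_pre 1 X"
    unfolding hausdorff1_pre_def
  proof (rule INF_greatest, clarify)
    fix U :: "nat \<Rightarrow> 'a set"
    assume X: "X \<subseteq> (\<Union>n. U n)" and U: "\<forall>n. ediam (U n) \<le> ennreal 1"
    define d where "d n = enn2real (ediam (U n))" for n
    have d: "ediam (U n) = ennreal (d n)" "0 \<le> d n" for n
      using U le_less_trans[of "ediam (U n)" "ennreal 1" top] by (auto simp: d_def)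
    define V where "V n = (if U n = {} then {} else {Sup (f ` U n) - d n .. Sup (f ` U n)})" for n
    have fU: "f ` U n \<subseteq> V n" for n
    proof clarify
      fix x assume x: "x \<in> U n"
      have le: "f y \<le> f x + d n" if "y \<in> U n" for y
      proof -
        have "ennreal (dist x y) \<le> ennreal (d n)"
          unfolding d(1)[symmetric] using x that by (rule dist_le_ediam)
        then have "dist x y \<le> d n" using d(2)[of n] by simp
        then show ?thesis using lip[of y x] by (simp add: dist_commute)
      qed
      have "f x \<le> Sup (f ` U n)"
        using x le by (intro cSup_upper bdd_aboveI2[where M = "f x + d n"]) auto
      moreover have "Sup (f ` U n) \<le> f x + d n"
        using x le by (intro cSup_least) auto
      ultimately show "f x \<in> V n" using x by (auto simp: V_def)
    qed
    have "S \<subseteq> f ` (\<Union>n. U n)" using S(2) X by (meson image_mono order_trans)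
    also have "\<dots> \<subseteq> (\<Union>n. V n)" unfolding image_UN by (intro UN_mono fU) simp
    finally have "S \<subseteq> (\<Union>n. V n)" .
    moreover have [measurable]: "V n \<in> sets borel" for n by (simp add: V_def)
    ultimately have "emeasure lborel S \<le> emeasure lborel (\<Union>n. V n)"
      by (intro emeasure_mono) auto
    also have "\<dots> \<le> (\<Sum>n. emeasure lborel (V n))"
      by (intro emeasure_subadditive_countably) (auto simp: V_def)
    also have "\<dots> \<le> (\<Sum>n. ediam (U n))"
      by (intro suminf_le) (auto simp: V_def d)
    finally show "emeasure lborel S \<le> (\<Sum>n. ediam (U n))" .
  qed
  also have "\<dots> \<le> hausdorff1_outer X" by (rule hausdorff1_pre_le_outer) simp
  finally show ?thesis .
qed

section \<open>Coordinates and the kernel\<close>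

lemma abs_hz_le_koranyi_norm: "\<bar>hz p\<bar> \<le> (koranyi_norm p)\<^sup>2"
  unfolding koranyi_norm_power2 using abs_Im_le_cmod[of "Complex ((hx p)\<^sup>2 + (hy p)\<^sup>2) (hz p)"] by simp

lemma hxy_le_koranyi_norm: "(hx p)\<^sup>2 + (hy p)\<^sup>2 \<le> (koranyi_norm p)\<^sup>2"
  unfolding koranyi_norm_power2 using complex_Re_le_cmod[of "Complex ((hx p)\<^sup>2 + (hy p)\<^sup>2) (hz p)"] by simp

lemma abs_hx_diff_le_dist: "\<bar>hx p - hx q\<bar> \<le> dist p q"
proof (rule power2_le_imp_le)
  have "hx (- q + p) = hx p - hx q" by (simp add: plus_heis_def uminus_heis_def)
  moreover have "(hx (- q + p))\<^sup>2 \<le> (koranyi_norm (- q + p))\<^sup>2"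
    using hxy_le_koranyi_norm[of "- q + p"] zero_le_power2[of "hy (- q + p)"] by linarith
  ultimately show "\<bar>hx p - hx q\<bar>\<^sup>2 \<le> (dist p q)\<^sup>2"
    by (simp add: dist_heis_def)
qed simp

lemma abs_hy_diff_le_dist: "\<bar>hy p - hy q\<bar> \<le> dist p q"
proof (rule power2_le_imp_le)
  have "hy (- q + p) = hy p - hy q" by (simp add: plus_heis_def uminus_heis_def)
  moreover have "(hy (- q + p))\<^sup>2 \<le> (koranyi_norm (- q + p))\<^sup>2"
    using hxy_le_koranyi_norm[of "- q + p"] zero_le_power2[of "hx (- q + p)"] by linarith
  ultimately show "\<bar>hy p - hy q\<bar>\<^sup>2 \<le> (dist p q)\<^sup>2"
    by (simp add: dist_heis_def)
qed simp

lemma continuous_on_hx [continuous_intros]: "continuous_on S hx"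
  by (rule lipschitz_on_continuous_on[of 1])
    (auto intro!: lipschitz_onI simp: dist_real_def abs_hx_diff_le_dist)

lemma continuous_on_hy [continuous_intros]: "continuous_on S hy"
  by (rule lipschitz_on_continuous_on[of 1])
    (auto intro!: lipschitz_onI simp: dist_real_def abs_hy_diff_le_dist)

text \<open>The height of \<open>- p + q\<close> is at most the square of the distance from \<open>p\<close> to \<open>q\<close>, and \<open>hz q - hz p\<close>
  differs from it by a term that is linear in \<open>hx q\<close> and \<open>hy q\<close>.\<close>

lemma isCont_hz: "isCont hz p"
proof -
  have eq: "hz q = hz p + hz (- p + q) - (hy p * hx q - hx p * hy q) / 2" for q
    by (simp add: plus_heis_def uminus_heis_def field_simps)
  have "((\<lambda>q. hz (- p + q)) \<longlongrightarrow> 0) (at p)"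
  proof (rule Lim_null_comparison)
    show "eventually (\<lambda>q. norm (hz (- p + q)) \<le> (dist q p)\<^sup>2) (at p)"
      by (intro always_eventually) (auto simp: dist_heis_def abs_hz_le_koranyi_norm)
    have "((\<lambda>q. (dist q p)\<^sup>2) \<longlongrightarrow> (dist p p)\<^sup>2) (at p)"
      by (intro tendsto_intros)
    then show "((\<lambda>q. (dist q p)\<^sup>2) \<longlongrightarrow> 0) (at p)" by simp
  qed
  moreover have "(hx \<longlongrightarrow> hx p) (at p)" "(hy \<longlongrightarrow> hy p) (at p)"
    using continuous_on_hx[of UNIV] continuous_on_hy[of UNIV] by (auto simp: continuous_on_def)
  ultimately have "((\<lambda>q. hz p + hz (- p + q) - (hy p * hx q - hx p * hy q) / 2)
      \<longlongrightarrow> hz p + 0 - (hy p * hx p - hx p * hy p) / 2) (at p)"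
    by (intro tendsto_intros) auto
  then have "(hz \<longlongrightarrow> hz p) (at p)" unfolding eq[symmetric] by simp
  then show ?thesis by (simp add: isCont_def)
qed

lemma continuous_on_hz [continuous_intros]: "continuous_on S hz"
  by (simp add: continuous_at_imp_continuous_on isCont_hz)

lemma measurable_hx [measurable]: "hx \<in> borel_measurable borel"
  and measurable_hy [measurable]: "hy \<in> borel_measurable borel"
  and measurable_hz [measurable]: "hz \<in> borel_measurable borel"
  by (auto intro!: borel_measurable_continuous_onI continuous_intros)

lemma measurable_heis_kernel_translate [measurable]:
  "(\<lambda>q. heis_kernel \<alpha> (- p + q)) \<in> borel_measurable borel"
proof -
  have "heis_kernel \<alpha> (- p + q) =
      \<bar>hz q - hz p + (hy p * hx q - hx p * hy q) / 2\<bar> powr (\<alpha> / 2) / dist q p powr (\<alpha> + 1)" for q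
    by (simp add: heis_kernel_def dist_heis_def plus_heis_def uminus_heis_def field_simps)
  moreover have [measurable]: "(\<lambda>q. dist q p) \<in> borel_measurable borel"
    by (intro borel_measurable_continuous_onI continuous_intros)
  ultimately show ?thesis by simp
qed

lemma heis_kernel_nonneg: "0 \<le> heis_kernel \<alpha> p"
  by (simp add: heis_kernel_def)

lemma heis_kernel_le_inverse_norm:
  assumes "0 < \<alpha>"
  shows "heis_kernel \<alpha> p \<le> 1 / koranyi_norm p"
proof (cases "koranyi_norm p = 0")
  case False
  then have k: "0 < koranyi_norm p" using koranyi_norm_nonneg[of p] by simp
  have "\<bar>hz p\<bar> powr (\<alpha> / 2) \<le> ((koranyi_norm p)\<^sup>2) powr (\<alpha> / 2)"
    using assms by (intro powr_mono2 abs_hz_le_koranyi_norm) auto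
  also have "\<dots> = koranyi_norm p powr \<alpha>"
    using k powr_powr[of "koranyi_norm p" 2 "\<alpha> / 2"] by simp
  finally have "heis_kernel \<alpha> p \<le> koranyi_norm p powr \<alpha> / koranyi_norm p powr (\<alpha> + 1)"
    unfolding heis_kernel_def by (rule divide_right_mono) simp
  also have "\<dots> = 1 / koranyi_norm p" using k by (simp add: powr_add)
  finally show ?thesis .
qed (simp add: heis_kernel_def)

section \<open>Horizontal lifts of Lipschitz graphs\<close>

definition horizontal_lift :: "(real \<Rightarrow> real) \<Rightarrow> (real \<Rightarrow> real) \<Rightarrow> real \<Rightarrow> heis" where
  "horizontal_lift f F t = Heis t (f t) (t * f t / 2 - F t)"

definition trapezoid_error :: "(real \<Rightarrow> real) \<Rightarrow> (real \<Rightarrow> real) \<Rightarrow> real \<Rightarrow> real \<Rightarrow> real" where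
  "trapezoid_error f F s t = (t - s) * (f s + f t) / 2 - (F t - F s)"

text \<open>With \<open>F\<close> an antiderivative of \<open>f\<close>, the curve \<^const>\<open>horizontal_lift\<close> is the horizontal lift of the
  graph of \<open>f\<close>, and its relative height is the signed area between the graph and its chord,
  that is, the error of the trapezoid rule.\<close>

lemma horizontal_lift_difference:
  "- horizontal_lift f F s + horizontal_lift f F t = Heis (t - s) (f t - f s) (trapezoid_error f F s t)"
  by (simp add: horizontal_lift_def trapezoid_error_def plus_heis_def uminus_heis_def field_simps)

lemma hx_horizontal_lift [simp]: "hx (horizontal_lift f F t) = t"
  by (simp add: horizontal_lift_def)

text \<open>Together the two bounds make the lift Lipschitz for the Koranyi metric: the norm is of the
  order of the horizontal displacement plus the square root of the height.\<close>

locale lipschitz_lift =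
  fixes f F :: "real \<Rightarrow> real" and l :: real
  assumes f_lip: "\<bar>f t - f s\<bar> \<le> l * \<bar>t - s\<bar>"
    and trapezoid_le: "\<bar>trapezoid_error f F s t\<bar> \<le> l * (t - s)\<^sup>2"
begin

abbreviation "\<gamma> \<equiv> horizontal_lift f F"
abbreviation "E \<equiv> range \<gamma>"
definition "L = 2 * (1 + l\<^sup>2)"

lemma L_ge_1: "1 \<le> L"
  using zero_le_power2[of l] by (simp add: L_def)

lemma dist_lift_ge: "\<bar>t - s\<bar> \<le> dist (\<gamma> t) (\<gamma> s)"
  using abs_hx_diff_le_dist[of "\<gamma> t" "\<gamma> s"] by simp

lemma dist_lift_le: "dist (\<gamma> t) (\<gamma> s) \<le> L * \<bar>t - s\<bar>"
proof -
  define h where "h = \<bar>t - s\<bar>"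
  define A where "A = trapezoid_error f F s t"
  have l: "0 \<le> l" using abs_ge_zero[of "f 1 - f 0"] f_lip[of 1 0] by simp
  have 1: "(f t - f s)\<^sup>2 \<le> l\<^sup>2 * h\<^sup>2"
    using power_mono[OF f_lip[of t s], of 2] by (simp add: h_def power_mult_distrib)
  have 2: "A\<^sup>2 \<le> (l * h\<^sup>2)\<^sup>2"
    using power_mono[OF trapezoid_le[of s t], of 2] by (simp add: h_def A_def)
  have "((t - s)\<^sup>2 + (f t - f s)\<^sup>2)\<^sup>2 \<le> ((1 + l\<^sup>2) * h\<^sup>2)\<^sup>2"
    using 1 by (intro power_mono) (auto simp: h_def algebra_simps)
  then have "((t - s)\<^sup>2 + (f t - f s)\<^sup>2)\<^sup>2 + A\<^sup>2 \<le> ((1 + l\<^sup>2) * h\<^sup>2)\<^sup>2 + (l * h\<^sup>2)\<^sup>2"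
    using 2 by (rule add_mono)
  also have "\<dots> = ((1 + l\<^sup>2)\<^sup>2 + l\<^sup>2) * h ^ 4"
    by algebra
  also have "\<dots> \<le> L ^ 4 * h ^ 4"
  proof (rule mult_right_mono)
    have "1 \<le> (1 + l\<^sup>2)\<^sup>2" by (intro one_le_power) simp
    have "L ^ 4 = 16 * ((1 + l\<^sup>2)\<^sup>2 * (1 + l\<^sup>2)\<^sup>2)"
      unfolding L_def power_mult_distrib by (simp flip: power_add)
    also have "\<dots> \<ge> 16 * ((1 + l\<^sup>2)\<^sup>2 * 1)"
      using \<open>1 \<le> (1 + l\<^sup>2)\<^sup>2\<close> by (intro mult_left_mono) auto
    finally have "16 * (1 + l\<^sup>2)\<^sup>2 \<le> L ^ 4" by simp
    moreover have "(1 + l\<^sup>2)\<^sup>2 + l\<^sup>2 \<le> 16 * (1 + l\<^sup>2)\<^sup>2"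
      by (simp add: power2_sum)
    ultimately show "(1 + l\<^sup>2)\<^sup>2 + l\<^sup>2 \<le> L ^ 4" by linarith
  qed simp
  finally have "root 4 (((t - s)\<^sup>2 + (f t - f s)\<^sup>2)\<^sup>2 + A\<^sup>2) \<le> root 4 ((L * h) ^ 4)"
    by (simp add: power_mult_distrib)
  also have "\<dots> = L * h"
    using L_ge_1 by (intro real_root_power_cancel) (auto simp: h_def)
  finally show ?thesis
    by (simp add: dist_heis_def horizontal_lift_difference koranyi_norm_def A_def h_def)
qed

lemma lipschitz_lift: "L-lipschitz_on S \<gamma>"
  using L_ge_1 by (auto intro!: lipschitz_onI dist_lift_le simp: dist_real_def)

lemma continuous_lift: "continuous_on S \<gamma>"
  by (rule lipschitz_on_continuous_on[OF lipschitz_lift])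

lemma measurable_lift [measurable]: "\<gamma> \<in> borel_measurable borel"
  by (intro borel_measurable_continuous_onI continuous_lift)

lemma closed_curve: "closed E"
proof -
  have "E = {p. p = \<gamma> (hx p)}" by (auto simp: image_def)
  moreover have "closed {p. p = \<gamma> (hx p)}"
    by (intro closed_Collect_eq continuous_intros continuous_on_compose2[OF continuous_lift]) auto
  ultimately show ?thesis by simp
qed

lemma borel_curve [measurable]: "E \<in> sets borel"
  using closed_curve by (rule borel_closed)

text \<open>Pushing Lebesgue measure forward along the lift gives a lower bound for the Hausdorff measure of
  the curve, since \<^const>\<open>hx\<close> is a 1-Lipschitz left inverse of the lift.\<close>

lemma emeasure_curve_ge:
  assumes "B \<in> sets borel"
  shows "emeasure lborel (\<gamma> -` B) \<le> emeasure hausdorff1 (E \<inter> B)"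
proof -
  have "emeasure lborel (\<gamma> -` B) \<le> hausdorff1_outer (E \<inter> B)"
  proof (rule emeasure_lborel_le_hausdorff1_outer[OF abs_hx_diff_le_dist])
    show "\<gamma> -` B \<in> sets borel"
      using measurable_sets[OF measurable_lift assms] by simp
    show "\<gamma> -` B \<subseteq> hx ` (E \<inter> B)" by force
  qed
  also have "\<dots> = emeasure hausdorff1 (E \<inter> B)"
    using assms by (intro emeasure_hausdorff1[symmetric]) auto
  finally show ?thesis .
qed

lemma nn_integral_curve_ge:
  assumes [measurable]: "g \<in> borel_measurable borel"
  shows "(\<integral>\<^sup>+t. g (\<gamma> t) \<partial>lborel) \<le> (\<integral>\<^sup>+q. g q * indicator E q \<partial>hausdorff1)"
proof -
  have "(\<integral>\<^sup>+t. g (\<gamma> t) \<partial>lborel) = (\<integral>\<^sup>+q. g q \<partial>distr lborel borel \<gamma>)"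
    by (subst nn_integral_distr) auto
  also have "\<dots> \<le> (\<integral>\<^sup>+q. g q \<partial>density hausdorff1 (indicator E))"
  proof (rule nn_integral_mono_measure)
    show "distr lborel borel \<gamma> \<le> density hausdorff1 (indicator E)"
      by (subst le_measure)
        (auto simp: emeasure_distr emeasure_density emeasure_curve_ge
           simp flip: indicator_inter_arith)
  qed simp
  also have "\<dots> = (\<integral>\<^sup>+q. indicator E q * g q \<partial>hausdorff1)"
    by (subst nn_integral_density) auto
  finally show ?thesis by (simp add: mult.commute)
qed

lemma emeasure_arc_le:
  assumes "B \<in> sets borel" "a \<le> b" "B \<subseteq> \<gamma> ` {a..b}"
  shows "emeasure hausdorff1 B \<le> ennreal (L * (b - a))"
  using assms hausdorff1_outer_mono[OF assms(3)]
    hausdorff1_outer_lipschitz_image_le[OF lipschitz_lift, of a b]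
  by (simp add: emeasure_hausdorff1)

lemma ahlfors_regular_curve: "ahlfors_regular1_curve E"
proof -
  have lower: "ennreal (inverse (2 * L) * r) \<le> emeasure hausdorff1 (ball (\<gamma> s) r \<inter> E)"
    if "0 < r" for s r
  proof -
    have rL: "0 < r / L" using that L_ge_1 by simp
    have sub: "{s <..< s + r / L} \<subseteq> \<gamma> -` ball (\<gamma> s) r"
    proof
      fix t assume t: "t \<in> {s <..< s + r / L}"
      have "dist (\<gamma> s) (\<gamma> t) \<le> L * \<bar>s - t\<bar>" by (rule dist_lift_le)
      also have "\<dots> < L * (r / L)" using t L_ge_1 by (intro mult_strict_left_mono) auto
      finally show "t \<in> \<gamma> -` ball (\<gamma> s) r" using L_ge_1 by simp
    qed
    have "ennreal (inverse (2 * L) * r) \<le> ennreal (r / L)"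
      using that L_ge_1 by (intro ennreal_leI) (simp add: field_simps)
    also have "\<dots> = emeasure lborel {s <..< s + r / L}" using rL by simp
    also have "\<dots> \<le> emeasure lborel (\<gamma> -` ball (\<gamma> s) r)"
      using measurable_sets[OF measurable_lift, of "ball (\<gamma> s) r"]
      by (intro emeasure_mono sub) auto
    also have "\<dots> \<le> emeasure hausdorff1 (E \<inter> ball (\<gamma> s) r)"
      by (rule emeasure_curve_ge) simp
    finally show ?thesis by (simp add: Int_commute)
  qed
  have upper: "emeasure hausdorff1 (ball (\<gamma> s) r \<inter> E) \<le> ennreal (2 * L * r)" if "0 < r" for s r
  proof -
    have "ball (\<gamma> s) r \<inter> E \<subseteq> \<gamma> ` {s - r .. s + r}"
    proof clarify
      fix t assume "\<gamma> t \<in> ball (\<gamma> s) r"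
      then have "\<bar>s - t\<bar> < r" using dist_lift_ge[of s t] by (simp only: mem_ball)
      then show "\<gamma> t \<in> \<gamma> ` {s - r .. s + r}" by (intro imageI) auto
    qed
    then show ?thesis
      using emeasure_arc_le[of "ball (\<gamma> s) r \<inter> E" "s - r" "s + r"] that
      by (simp add: mult.commute mult.left_commute)
  qed
  have "ahlfors_regular1 E"
    unfolding ahlfors_regular1_def using lower upper L_ge_1
    by (intro conjI borel_curve exI[of _ "2 * L"]) auto
  moreover have "is_interval (UNIV :: real set)" by simp
  ultimately show ?thesis
    unfolding ahlfors_regular1_curve_def using lipschitz_lift by blast
qed

end

text \<open>A bound for arbitrary functions \<open>g\<close>: it applies to truncated singular integrals without any
  study of their measurability in the base point.\<close>

lemma L2_enorm_ge:
  assumes E: "E \<in> sets borel" and P: "P \<in> sets borel" "P \<subseteq> E" "1 \<le> emeasure hausdorff1 P"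
    and M: "0 \<le> M" "\<And>p. p \<in> P \<Longrightarrow> M \<le> g p"
  shows "ennreal M \<le> L2_enorm E g"
proof -
  define I where "I = (\<integral>\<^sup>+ p. ennreal ((g p)\<^sup>2) \<partial>restrict_space hausdorff1 E)"
  have "ennreal (M\<^sup>2) \<le> ennreal (M\<^sup>2) * emeasure hausdorff1 P"
    using P(3) mult_left_mono[of 1 "emeasure hausdorff1 P" "ennreal (M\<^sup>2)"] by simp
  also have "\<dots> = (\<integral>\<^sup>+p. ennreal (M\<^sup>2) * indicator P p \<partial>hausdorff1)"
    using P by (intro nn_integral_cmult_indicator[symmetric]) simp
  also have "\<dots> \<le> (\<integral>\<^sup>+p. ennreal ((g p)\<^sup>2) * indicator E p \<partial>hausdorff1)"
    using M P(2) by (intro nn_integral_mono) (auto simp: indicator_def intro!: ennreal_leI power_mono)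
  also have "\<dots> = I" unfolding I_def using E by (subst nn_integral_restrict_space) auto
  finally have I: "ennreal (M\<^sup>2) \<le> I" .
  show ?thesis
  proof (cases "I = \<infinity>")
    case False
    then obtain r where r: "I = ennreal r" "0 \<le> r" by (cases I) auto
    then have "M \<le> sqrt r" using I M by (intro real_le_rsqrt) simp
    then show ?thesis using r False by (simp add: L2_enorm_def I_def[symmetric] Let_def ennreal_leI)
  qed (simp add: L2_enorm_def I_def[symmetric] Let_def)
qed

context lipschitz_lift
begin

text \<open>The kernel is nonnegative, so there is no cancellation: testing on the indicator of the arc over
  \<open>{0..2}\<close>, whose norm is finite and fixed, it suffices that the truncated integrals over \<open>{s..s + 1}\<close>
  become large uniformly in \<open>s \<in> {0..1}\<close>.\<close>

lemma not_SIO_bounded_L2_if_diverges: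
  assumes \<alpha>: "0 < \<alpha>"
    and div: "\<And>M. \<exists>\<epsilon>>0. \<forall>s\<in>{0..1}.
      ennreal M \<le> (\<integral>\<^sup>+x. ennreal (heis_kernel \<alpha> (- \<gamma> s + \<gamma> x)) * indicator {s + \<epsilon>..s + 1} x \<partial>lborel)"
  shows "\<not> SIO_bounded_L2 (heis_kernel \<alpha>) E"
proof
  assume "SIO_bounded_L2 (heis_kernel \<alpha>) E"
  then obtain C where C: "0 < C" and bounded:
    "\<And>g \<epsilon>. g \<in> L2 E \<Longrightarrow> 0 < \<epsilon> \<Longrightarrow>
      L2_enorm E (truncated_SIO (heis_kernel \<alpha>) E \<epsilon> g) \<le> ennreal C * L2_enorm E g"
    unfolding SIO_bounded_L2_def by blast
  define S where "S = E \<inter> hx -` {0..2}"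
  define g where "g = (indicator S :: heis \<Rightarrow> real)"
  have [measurable]: "hx -` {a..b} \<in> sets borel" for a b
    using measurable_sets[OF measurable_hx, of "{a..b}"] by simp
  have S [measurable]: "S \<in> sets borel" unfolding S_def by measurable
  have "S \<subseteq> \<gamma> ` {0..2}" by (auto simp: S_def)
  then have S_fin: "emeasure hausdorff1 S \<le> ennreal (L * 2)"
    using emeasure_arc_le[OF S, of 0 2] by simp
  have "(\<integral>\<^sup>+ p. ennreal ((g p)\<^sup>2) \<partial>restrict_space hausdorff1 E) = emeasure hausdorff1 S"
  proof -
    have "(\<integral>\<^sup>+ p. ennreal ((g p)\<^sup>2) \<partial>restrict_space hausdorff1 E)
        = (\<integral>\<^sup>+ p. ennreal ((g p)\<^sup>2) * indicator E p \<partial>hausdorff1)"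
      using borel_curve by (intro nn_integral_restrict_space) simp
    also have "\<dots> = (\<integral>\<^sup>+ p. indicator S p \<partial>hausdorff1)"
      by (intro nn_integral_cong) (auto simp: g_def S_def indicator_def)
    finally show ?thesis by simp
  qed
  then have norm_g: "L2_enorm E g < \<infinity>"
    using le_less_trans[OF S_fin ennreal_less_top] by (auto simp: L2_enorm_def Let_def)
  have "g \<in> borel_measurable (restrict_space hausdorff1 E)"
    unfolding g_def by (intro measurable_restrict_space1) simp
  with norm_g have g: "g \<in> L2 E" by (simp add: L2_def)
  obtain D where D: "0 \<le> D" "ennreal C * L2_enorm E g = ennreal D"
  proof -
    obtain r where "0 \<le> r" "L2_enorm E g = ennreal r" using norm_g by (cases "L2_enorm E g") auto
    then show ?thesis using C that[of "C * r"] by (simp add: ennreal_mult)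
  qed
  obtain \<epsilon> where \<epsilon>: "0 < \<epsilon>" and large: "\<And>s. s \<in> {0..1} \<Longrightarrow> ennreal (D + 1) \<le>
      (\<integral>\<^sup>+x. ennreal (heis_kernel \<alpha> (- \<gamma> s + \<gamma> x)) * indicator {s + \<epsilon>..s + 1} x \<partial>lborel)"
    using div[of "D + 1"] by blast
  let ?T = "truncated_SIO (heis_kernel \<alpha>) E \<epsilon> g"
  have T: "D + 1 \<le> ?T (\<gamma> s)" if s: "s \<in> {0..1}" for s
  proof -
    define p where "p = \<gamma> s"
    define k where "k q = indicator (E - ball p \<epsilon>) q * (heis_kernel \<alpha> (- p + q) * g q)" for q
    have k_meas [measurable]: "k \<in> borel_measurable borel"
      unfolding k_def g_def
      by (intro borel_measurable_times borel_measurable_indicator measurable_heis_kernel_translate S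
          sets.Diff borel_curve) auto
    have k0: "0 \<le> k q" for q
      by (simp add: k_def g_def heis_kernel_nonneg)
    have k_le: "k q \<le> 1 / \<epsilon> * indicator S q" for q
    proof (cases "q \<in> (E - ball p \<epsilon>) \<inter> S")
      case True
      then have "\<epsilon> \<le> dist p q" by simp
      then have "\<epsilon> \<le> koranyi_norm (- p + q)" by (metis dist_commute dist_heis_def)
      then have "1 / koranyi_norm (- p + q) \<le> 1 / \<epsilon>" using \<epsilon> by (intro divide_left_mono) auto
      then show ?thesis
        using heis_kernel_le_inverse_norm[OF \<alpha>, of "- p + q"] True by (simp add: k_def g_def)
    next
      case False
      then show ?thesis using \<epsilon> by (auto simp: k_def g_def)
    qed
    have fin: "(\<integral>\<^sup>+q. ennreal (k q) \<partial>hausdorff1) < \<infinity>"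
    proof -
      have "(\<integral>\<^sup>+q. ennreal (k q) \<partial>hausdorff1) \<le> (\<integral>\<^sup>+q. ennreal (1 / \<epsilon>) * indicator S q \<partial>hausdorff1)"
      proof (intro nn_integral_mono)
        fix q
        have "ennreal (k q) \<le> ennreal (1 / \<epsilon> * indicator S q)" by (intro ennreal_leI k_le)
        also have "\<dots> = ennreal (1 / \<epsilon>) * indicator S q" by (auto simp: indicator_def)
        finally show "ennreal (k q) \<le> ennreal (1 / \<epsilon>) * indicator S q" .
      qed
      also have "\<dots> = ennreal (1 / \<epsilon>) * emeasure hausdorff1 S"
        by (intro nn_integral_cmult_indicator) simp
      also have "\<dots> \<le> ennreal (1 / \<epsilon>) * ennreal (L * 2)"
        using S_fin by (intro mult_left_mono) auto
      also have "\<dots> < \<infinity>" by (simp add: ennreal_mult_less_top)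
      finally show ?thesis .
    qed
    have int: "integrable hausdorff1 k"
      using fin k0 by (intro integrableI_nonneg) auto
    have "ennreal (D + 1) \<le>
        (\<integral>\<^sup>+x. ennreal (heis_kernel \<alpha> (- \<gamma> s + \<gamma> x)) * indicator {s + \<epsilon>..s + 1} x \<partial>lborel)"
      using s by (rule large)
    also have "\<dots> \<le> (\<integral>\<^sup>+x. ennreal (k (\<gamma> x)) \<partial>lborel)"
    proof (intro nn_integral_mono)
      fix x
      show "ennreal (heis_kernel \<alpha> (- \<gamma> s + \<gamma> x)) * indicator {s + \<epsilon>..s + 1} x \<le> ennreal (k (\<gamma> x))"
      proof (cases "x \<in> {s + \<epsilon>..s + 1}")
        case True
        then have "\<gamma> x \<in> S" using s \<epsilon> by (auto simp: S_def)
        moreover have "\<not> dist p (\<gamma> x) < \<epsilon>"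
          using dist_lift_ge[of s x] True unfolding p_def by (auto simp: not_less)
        ultimately show ?thesis using True by (simp add: k_def g_def p_def)
      qed simp
    qed
    also have "\<dots> \<le> (\<integral>\<^sup>+q. ennreal (k q) * indicator E q \<partial>hausdorff1)"
      by (rule nn_integral_curve_ge) measurable
    also have "\<dots> = (\<integral>\<^sup>+q. ennreal (k q) \<partial>hausdorff1)"
      by (intro nn_integral_cong) (auto simp: k_def indicator_def)
    also have "\<dots> = ennreal (LINT q|hausdorff1. k q)"
      using int k0 by (intro nn_integral_eq_integral) auto
    also have "(LINT q|hausdorff1. k q) = ?T (\<gamma> s)"
      by (simp add: truncated_SIO_def set_lebesgue_integral_def k_def p_def)
    finally show ?thesis
      using D(1) unfolding ennreal_le_iff2 by linarith
  qed
  define P where "P = E \<inter> hx -` {0..1}"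
  have P [measurable]: "P \<in> sets borel" unfolding P_def by measurable
  have "1 \<le> emeasure hausdorff1 P"
  proof -
    have "\<gamma> -` (hx -` {0..1}) = {0..1::real}" by (auto simp: vimage_def)
    then show ?thesis
      using emeasure_curve_ge[of "hx -` {0..1}"] by (simp add: P_def)
  qed
  then have "ennreal (D + 1) \<le> L2_enorm E ?T"
    using T D(1) by (intro L2_enorm_ge[OF borel_curve P]) (auto simp: P_def)
  also have "\<dots> \<le> ennreal D" using bounded[OF g \<epsilon>] D by simp
  finally show False using D(1) unfolding ennreal_le_iff2 by linarith
qed

end

section \<open>A lacunary cosine series\<close>

text \<open>The trapezoid error on intervals of length \<open>h\<close> is a translation invariant functional, so cosines
  are eigenfunctions; up to normalisation, this is the eigenvalue at frequency \<open>u / (pi * h)\<close>. It is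
  cubically small for low frequencies, linearly bounded for high ones, and bounded below when the
  interval is about half a period to one period long.\<close>

definition trapezoid_symbol :: "real \<Rightarrow> real" where "trapezoid_symbol u = u * cos u - sin u"

lemma abs_trapezoid_symbol_le_2: "\<bar>trapezoid_symbol u\<bar> \<le> 2 * \<bar>u\<bar>"
proof -
  have "\<bar>u * cos u\<bar> \<le> \<bar>u\<bar>" by (simp add: abs_mult mult_left_le)
  then show ?thesis using abs_sin_x_le_abs_x[of u] unfolding trapezoid_symbol_def by linarith
qed

lemma trapezoid_symbol_minus: "trapezoid_symbol (- u) = - trapezoid_symbol u" by (simp add: trapezoid_symbol_def)

lemma abs_trapezoid_symbol_le_cube: "\<bar>trapezoid_symbol u\<bar> \<le> \<bar>u\<bar> ^ 3"
proof -
  have nonneg: "\<bar>trapezoid_symbol u\<bar> \<le> u ^ 3" if "0 \<le> u" for u :: real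
  proof -
    have dw: "(trapezoid_symbol has_real_derivative - (x * sin x)) (at x)" for x
      unfolding trapezoid_symbol_def[abs_def] by (auto intro!: derivative_eq_intros)
    have xs: "\<bar>x * sin x\<bar> \<le> 3 * x\<^sup>2" for x :: real
    proof -
      have "\<bar>x * sin x\<bar> \<le> \<bar>x\<bar> * \<bar>x\<bar>"
        unfolding abs_mult by (intro mult_left_mono abs_sin_x_le_abs_x) simp
      also have "\<dots> \<le> 3 * x\<^sup>2" by (simp add: power2_eq_square flip: abs_mult)
      finally show ?thesis .
    qed
    have "(\<lambda>x. x ^ 3 - trapezoid_symbol x) 0 \<le> (\<lambda>x. x ^ 3 - trapezoid_symbol x) u"
    proof (rule DERIV_nonneg_imp_nondecreasing[OF that])
      fix x
      have "((\<lambda>x. x ^ 3 - trapezoid_symbol x) has_real_derivative 3 * x\<^sup>2 - - (x * sin x)) (at x)"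
        by (auto intro!: derivative_eq_intros dw)
      moreover have "0 \<le> 3 * x\<^sup>2 - - (x * sin x)" using xs[of x] by linarith
      ultimately show "\<exists>y. ((\<lambda>x. x ^ 3 - trapezoid_symbol x) has_real_derivative y) (at x) \<and> 0 \<le> y" by blast
    qed
    moreover have "(\<lambda>x. x ^ 3 + trapezoid_symbol x) 0 \<le> (\<lambda>x. x ^ 3 + trapezoid_symbol x) u"
    proof (rule DERIV_nonneg_imp_nondecreasing[OF that])
      fix x
      have "((\<lambda>x. x ^ 3 + trapezoid_symbol x) has_real_derivative 3 * x\<^sup>2 + - (x * sin x)) (at x)"
        by (auto intro!: derivative_eq_intros dw)
      moreover have "0 \<le> 3 * x\<^sup>2 + - (x * sin x)" using xs[of x] by linarith
      ultimately show "\<exists>y. ((\<lambda>x. x ^ 3 + trapezoid_symbol x) has_real_derivative y) (at x) \<and> 0 \<le> y" by blast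
    qed
    ultimately show ?thesis by (simp add: trapezoid_symbol_def abs_le_iff)
  qed
  show ?thesis
  proof (cases "0 \<le> u")
    case False
    then show ?thesis using nonneg[of "- u"] by (simp add: trapezoid_symbol_minus)
  qed (use nonneg in simp)
qed

lemma abs_trapezoid_symbol_le_square: "\<bar>trapezoid_symbol u\<bar> \<le> 2 * u\<^sup>2"
proof (cases "\<bar>u\<bar> \<le> 1")
  case True
  have "\<bar>u\<bar> ^ 3 \<le> \<bar>u\<bar> ^ 2" using True by (intro power_decreasing) auto
  then show ?thesis using abs_trapezoid_symbol_le_cube[of u] zero_le_power2[of u] unfolding power2_abs by linarith
next
  case False
  then have "\<bar>u\<bar> * 1 \<le> \<bar>u\<bar> * \<bar>u\<bar>" by (intro mult_left_mono) auto
  then show ?thesis using abs_trapezoid_symbol_le_2[of u] by (simp add: power2_eq_square flip: abs_mult)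
qed

lemma abs_trapezoid_symbol_ge_1:
  assumes "pi / 2 \<le> u" "u \<le> pi"
  shows "1 \<le> \<bar>trapezoid_symbol u\<bar>"
proof -
  have c: "cos u \<le> 0" "-1 \<le> cos u"
    using cos_monotone_0_pi_le[of "pi / 2" u] assms by auto
  have s: "0 \<le> sin u" "sin u \<le> 1" using assms pi_gt_zero by (auto intro!: sin_ge_zero)
  have u: "1 \<le> u" using assms pi_ge_two by simp
  \<comment> \<open>On this range both summands have the same sign, so they cannot cancel.\<close>
  have "1 = (cos u)\<^sup>2 + (sin u)\<^sup>2" by simp
  also have "\<dots> \<le> - cos u + sin u"
  proof (rule add_mono)
    show "(cos u)\<^sup>2 \<le> - cos u"
      using c mult_left_mono[of "- cos u" 1 "- cos u"] by (simp add: power2_eq_square)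
    show "(sin u)\<^sup>2 \<le> sin u"
      using s mult_left_mono[of "sin u" 1 "sin u"] by (simp add: power2_eq_square)
  qed
  also have "\<dots> \<le> - (u * cos u) + sin u"
    using c u mult_right_mono[of 1 u "- cos u"] by simp
  also have "\<dots> \<le> \<bar>trapezoid_symbol u\<bar>" unfolding trapezoid_symbol_def by linarith
  finally show ?thesis .
qed

lemma trapezoid_error_cos:
  assumes "0 < n"
  shows "trapezoid_error (\<lambda>x. cos (2 * pi * n * x)) (\<lambda>x. sin (2 * pi * n * x) / (2 * pi * n)) s t
    = cos (pi * n * (s + t)) * trapezoid_symbol (pi * n * (t - s)) / (pi * n)"
proof -
  define c where "c = pi * n * (s + t)"
  define u where "u = pi * n * (t - s)"
  have *: "2 * pi * n * s = c - u" "2 * pi * n * t = c + u"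
    by (simp_all add: c_def u_def algebra_simps)
  have u: "t - s = u / (pi * n)" using assms by (simp add: u_def)
  have "trapezoid_error (\<lambda>x. cos (2 * pi * n * x)) (\<lambda>x. sin (2 * pi * n * x) / (2 * pi * n)) s t
      = cos c * (u * cos u - sin u) / (pi * n)"
    unfolding trapezoid_error_def * u
    using assms by (simp add: cos_add cos_diff sin_add sin_diff field_simps)
  then show ?thesis by (simp add: c_def u_def trapezoid_symbol_def)
qed

text \<open>The interval carries half a period of the square of the cosine, whose mean over it need
  not be \<open>1/2\<close> but is bounded below whatever the phase. The loss of \<open>1/48\<close> leaves room for an
  error term in the lower bound of the trapezoid error of a lacunary series.\<close>

lemma nn_integral_cos_square_excess:
  assumes n: "0 < n"
  shows "ennreal (1 / 16) \<le> (\<integral>\<^sup>+x. ennreal (n * ((cos (pi * n * (s + x)))\<^sup>2 - 1 / 48))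
    * indicator {s + 1 / (2 * n)..s + 1 / n} x \<partial>lborel)"
    (is "_ \<le> ?X")
proof -
  let ?I = "{s + 1 / (2 * n)..s + 1 / n}"
  \<comment> \<open>An antiderivative of \<open>n * (cos (pi * n * (s + x)))\<^sup>2\<close>.\<close>
  define G where "G x = n * x / 2 + sin (2 * pi * n * (s + x)) / (4 * pi)" for x
  have le: "s + 1 / (2 * n) \<le> s + 1 / n" using n by (simp add: field_simps)
  have dG: "(G has_real_derivative n * (cos (pi * n * (s + x)))\<^sup>2) (at x)" for x
  proof -
    define C where "C = cos (2 * pi * n * (s + x))"
    define d where "d = cos (pi * n * (s + x))"
    have "C = 2 * d\<^sup>2 - 1"
      unfolding C_def d_def using cos_double_cos[of "pi * n * (s + x)"] by (simp only: mult.assoc)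
    then have "d\<^sup>2 = (1 + C) / 2" by simp
    then have "n / 2 + cos (2 * pi * n * (s + x)) * (2 * pi * n) / (4 * pi) = n * (cos (pi * n * (s + x)))\<^sup>2"
      unfolding C_def[symmetric] d_def[symmetric] by (simp add: field_simps)
    moreover have "(G has_real_derivative n / 2 + cos (2 * pi * n * (s + x)) * (2 * pi * n) / (4 * pi)) (at x)"
      unfolding G_def by (auto intro!: derivative_eq_intros)
    ultimately show ?thesis by simp
  qed
  have "(\<integral>\<^sup>+x. ennreal (n * (cos (pi * n * (s + x)))\<^sup>2) * indicator ?I x \<partial>lborel)
      = ennreal (G (s + 1 / n) - G (s + 1 / (2 * n)))"
    using n le by (intro nn_integral_FTC_Icc) (auto intro: has_field_derivative_at_within dG)
  also have "G (s + 1 / n) - G (s + 1 / (2 * n)) = 1 / 4 + sin (4 * pi * n * s) / (2 * pi)"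
  proof -
    define \<phi> where "\<phi> = 4 * pi * n * s"
    have "2 * pi * n * (s + (s + 1 / n)) = \<phi> + 2 * pi"
      and "2 * pi * n * (s + (s + 1 / (2 * n))) = \<phi> + pi"
      using n by (simp_all add: \<phi>_def field_simps)
    then have "G (s + 1 / n) = n * s / 2 + 1 / 2 + sin \<phi> / (4 * pi)"
      and "G (s + 1 / (2 * n)) = n * s / 2 + 1 / 4 - sin \<phi> / (4 * pi)"
      using n by (simp_all add: G_def distrib_left add_divide_distrib)
    then show ?thesis
      unfolding \<phi>_def[symmetric] by simp
  qed
  finally have int: "(\<integral>\<^sup>+x. ennreal (n * (cos (pi * n * (s + x)))\<^sup>2) * indicator ?I x \<partial>lborel)
      = ennreal (1 / 4 + sin (4 * pi * n * s) / (2 * pi))" .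
  have "1 / 12 \<le> 1 / 4 + sin (4 * pi * n * s) / (2 * pi)"
  proof -
    define X where "X = sin (4 * pi * n * s) / (2 * pi)"
    have "- 1 / (2 * pi) \<le> X" unfolding X_def by (intro divide_right_mono) auto
    moreover have "- 1 / 6 \<le> - 1 / (2 * pi)" using pi_gt3 by (simp add: field_simps)
    ultimately show ?thesis unfolding X_def[symmetric] by linarith
  qed
  then have "ennreal (1 / 12) \<le> (\<integral>\<^sup>+x. ennreal (n * (cos (pi * n * (s + x)))\<^sup>2) * indicator ?I x \<partial>lborel)"
    unfolding int by (rule ennreal_leI)
  also have "\<dots> \<le> (\<integral>\<^sup>+x. (ennreal (n * ((cos (pi * n * (s + x)))\<^sup>2 - 1 / 48)) * indicator ?I x
      + ennreal (n / 48) * indicator ?I x) \<partial>lborel)"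
  proof (intro nn_integral_mono)
    fix x
    \<comment> \<open>The integrand of the claim is truncated at 0 where the difference is negative, so it is
      bounded below by moving the subtracted constant to the other side.\<close>
    have excess: "ennreal a \<le> ennreal (a - b) + ennreal b" if "0 \<le> b" for a b :: real
    proof (cases "b \<le> a")
      case True
      then show ?thesis using that ennreal_plus[of "a - b" b] by (simp del: ennreal_plus)
    next
      case False
      then show ?thesis by (intro add_increasing ennreal_leI) auto
    qed
    have "ennreal (n * (cos (pi * n * (s + x)))\<^sup>2)
        \<le> ennreal (n * ((cos (pi * n * (s + x)))\<^sup>2 - 1 / 48)) + ennreal (n / 48)"
      using excess[of "n / 48" "n * (cos (pi * n * (s + x)))\<^sup>2"] n
      unfolding right_diff_distrib[of n] by simp
    then show "ennreal (n * (cos (pi * n * (s + x)))\<^sup>2) * indicator ?I x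
        \<le> ennreal (n * ((cos (pi * n * (s + x)))\<^sup>2 - 1 / 48)) * indicator ?I x + ennreal (n / 48) * indicator ?I x"
      by (simp add: indicator_def)
  qed
  also have "\<dots> = ?X + (\<integral>\<^sup>+x. ennreal (n / 48) * indicator ?I x \<partial>lborel)"
    by (rule nn_integral_add) auto
  also have "(\<integral>\<^sup>+x. ennreal (n / 48) * indicator ?I x \<partial>lborel) = ennreal (1 / 96)"
    using n le by (subst nn_integral_cmult_indicator) (auto simp: ennreal_mult[symmetric] field_simps)
  finally have "ennreal (1 / 12) \<le> ?X + ennreal (1 / 96)" .
  then show ?thesis
    by (cases ?X) (auto simp: ennreal_plus[symmetric] simp del: ennreal_plus)
qed

section \<open>Separation of scales in a lacunary series\<close>

lemma geometric_sum_off_diagonal_le: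
  fixes r :: real
  assumes r: "0 < r" "r \<le> 1 / 10000"
  defines "e k j \<equiv> if j = k then 0 else r ^ ((j - k) + (k - j))"
  shows "summable (e k)" "suminf (e k) \<le> 1 / 4000"
proof -
  have geo: "(\<lambda>j. r * r ^ j) sums (r * (1 / (1 - r)))"
    using r by (intro sums_mult geometric_sums) auto
  have tail: "(\<lambda>j. e k (j + Suc k)) sums (r / (1 - r))"
  proof -
    have "e k (j + Suc k) = r * r ^ j" for j by (simp add: e_def)
    then show ?thesis using geo by simp
  qed
  then show sum: "summable (e k)"
    using summable_iff_shift[of "e k" "Suc k"] by (simp add: sums_iff)
  have "suminf (e k) = (\<Sum>j. e k (j + Suc k)) + (\<Sum>j<Suc k. e k j)"
    by (rule suminf_split_initial_segment[OF sum])
  also have "(\<Sum>j<Suc k. e k j) = (\<Sum>j<k. e k j)" by (simp add: e_def)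
  also have "\<dots> = (\<Sum>j<k. r * r ^ (k - Suc j))"
    by (intro sum.cong) (auto simp: e_def Suc_diff_Suc simp flip: power_Suc)
  also have "\<dots> = (\<Sum>j<k. r * r ^ j)" by (rule sum.nat_diff_reindex)
  also have "\<dots> \<le> suminf (\<lambda>j. r * r ^ j)"
    using geo r by (intro sum_le_suminf) (auto simp: sums_iff)
  also have "(\<Sum>j. e k (j + Suc k)) + suminf (\<lambda>j. r * r ^ j) = 2 * (r / (1 - r))"
    using tail geo by (simp add: sums_iff)
  also have "\<dots> \<le> 1 / 4000" using r by (simp add: field_simps)
  finally show "suminf (e k) \<le> 1 / 4000" by simp
qed

lemma cos_lipschitz: "\<bar>cos x - cos y\<bar> \<le> \<bar>x - y\<bar>" for x y :: real
proof -
  have "\<bar>cos x - cos y\<bar> = 2 * (\<bar>sin ((x + y) / 2)\<bar> * \<bar>sin ((y - x) / 2)\<bar>)"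
    by (simp add: cos_diff_cos abs_mult)
  also have "\<dots> \<le> 2 * (1 * \<bar>(y - x) / 2\<bar>)"
    by (intro mult_left_mono mult_mono abs_sin_x_le_abs_x) auto
  finally show ?thesis by simp
qed

text \<open>The weights \<open>\<theta> k\<close> are the slopes at the successive scales. Summability keeps the sum
  of the series Lipschitz; the last assumption says that the weights vary at most geometrically, so
  that frequencies growing much faster than \<open>Q ^ k\<close> separate the scales.\<close>

locale lacunary =
  fixes \<theta> :: "nat \<Rightarrow> real" and Q :: real
  assumes \<theta>_pos: "0 < \<theta> k"
    and \<theta>_summable: "summable \<theta>"
    and \<theta>_le: "\<theta> j \<le> \<theta> k * Q ^ ((j - k) + (k - j))"
begin

text \<open>The factor 10000 makes the influence of all other scales on a given one smaller than the
  margin \<open>1/48\<close> of \<open>nn_integral_cos_square_excess\<close>.\<close>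

definition freq :: "nat \<Rightarrow> real" where "freq k = (10000 * Q) ^ k"

definition f :: "real \<Rightarrow> real" where
  "f x = (\<Sum>k. \<theta> k / freq k * cos (2 * pi * freq k * x))"

definition F :: "real \<Rightarrow> real" where
  "F x = (\<Sum>k. \<theta> k / freq k * (sin (2 * pi * freq k * x) / (2 * pi * freq k)))"

text \<open>The contribution of the \<open>k\<close>-th summand of \<open>f\<close> to the trapezoid error, with the eigenvalue made
  explicit.\<close>

definition trapezoid_term :: "real \<Rightarrow> real \<Rightarrow> nat \<Rightarrow> real" where
  "trapezoid_term s t k = \<theta> k / (pi * (freq k)\<^sup>2) * cos (pi * freq k * (s + t)) * trapezoid_symbol (pi * freq k * (t - s))"

lemma Q_ge_1: "1 \<le> Q"
proof -
  have "\<theta> 0 \<le> \<theta> 1 * Q" "\<theta> 1 \<le> \<theta> 0 * Q" using \<theta>_le[of 0 1] \<theta>_le[of 1 0] by auto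
  show ?thesis
  proof (rule ccontr)
    assume "\<not> 1 \<le> Q"
    then have "\<theta> 1 * Q < \<theta> 1 * 1" "\<theta> 0 * Q < \<theta> 0 * 1"
      using \<theta>_pos by (intro mult_strict_left_mono; simp)+
    then show False using \<open>\<theta> 0 \<le> \<theta> 1 * Q\<close> \<open>\<theta> 1 \<le> \<theta> 0 * Q\<close> by simp
  qed
qed

lemma freq_ge_1: "1 \<le> freq k"
  unfolding freq_def using Q_ge_1 by (intro one_le_power) simp

lemma freq_pos: "0 < freq k"
  using freq_ge_1[of k] by simp

lemma freq_add: "freq (j + m) = freq j * (10000 * Q) ^ m"
  by (simp add: freq_def power_add)

lemma summable_bound:
  assumes "\<And>k. \<bar>c k\<bar> \<le> C * \<theta> k"
  shows "summable c"
  by (rule summable_comparison_test'[OF summable_mult[OF \<theta>_summable, of C], of 0])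
    (simp add: assms)

lemma suminf_abs_le:
  assumes "\<And>k. \<bar>c k\<bar> \<le> C * \<theta> k"
  shows "\<bar>suminf c\<bar> \<le> C * suminf \<theta>"
proof -
  have "\<bar>suminf c\<bar> \<le> (\<Sum>k. C * \<theta> k)"
    using norm_suminf_le[of c "\<lambda>k. C * \<theta> k"] assms summable_mult[OF \<theta>_summable] by simp
  then show ?thesis by (simp add: suminf_mult \<theta>_summable)
qed

lemma f_term_le: "\<bar>\<theta> k / freq k * cos (2 * pi * freq k * x)\<bar> \<le> 1 * \<theta> k"
proof -
  have "\<bar>\<theta> k / freq k * cos (2 * pi * freq k * x)\<bar> \<le> (\<theta> k / freq k) * 1"
    unfolding abs_mult using \<theta>_pos[of k] freq_pos[of k] by (intro mult_mono) auto
  also have "\<dots> \<le> \<theta> k" using \<theta>_pos[of k] freq_ge_1[of k] by (simp add: divide_le_eq)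
  finally show ?thesis by simp
qed

lemma F_term_le: "\<bar>\<theta> k / freq k * (sin (2 * pi * freq k * x) / (2 * pi * freq k))\<bar> \<le> \<bar>x\<bar> * \<theta> k"
proof -
  have "\<bar>sin (2 * pi * freq k * x)\<bar> \<le> 2 * pi * freq k * \<bar>x\<bar>"
    using abs_sin_x_le_abs_x[of "2 * pi * freq k * x"] freq_pos[of k] by (simp add: abs_mult)
  then have "\<bar>sin (2 * pi * freq k * x) / (2 * pi * freq k)\<bar> \<le> \<bar>x\<bar>"
    using freq_pos[of k] by (simp add: abs_mult field_simps)
  moreover have "\<bar>\<theta> k / freq k\<bar> \<le> \<theta> k"
    using \<theta>_pos[of k] freq_ge_1[of k] by (simp add: divide_le_eq)
  ultimately show ?thesis
    unfolding abs_mult[of "\<theta> k / freq k"] using \<theta>_pos[of k]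
    by (subst mult.commute) (intro mult_mono, auto)
qed

lemmas summable_f = summable_bound[OF f_term_le]
lemmas summable_F = summable_bound[OF F_term_le]

lemma trapezoid_term_le: "\<bar>trapezoid_term s t k\<bar> \<le> (2 * pi * (t - s)\<^sup>2) * \<theta> k"
proof -
  have "\<bar>trapezoid_term s t k\<bar> \<le> \<theta> k / (pi * (freq k)\<^sup>2) * 1 * (2 * (pi * freq k * (t - s))\<^sup>2)"
    unfolding trapezoid_term_def abs_mult[of "_ * _"] abs_mult[of "_ / _"] using \<theta>_pos[of k]
    by (intro mult_mono abs_trapezoid_symbol_le_square) auto
  also have "\<dots> = (2 * pi * (t - s)\<^sup>2) * \<theta> k"
    using freq_pos[of k] by (simp add: field_simps power2_eq_square)
  finally show ?thesis .
qed

lemma trapezoid_error_sums: "trapezoid_term s t sums trapezoid_error f F s t"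
proof -
  let ?c = "\<lambda>k x. \<theta> k / freq k * cos (2 * pi * freq k * x)"
  let ?S = "\<lambda>k x. \<theta> k / freq k * (sin (2 * pi * freq k * x) / (2 * pi * freq k))"
  have "(\<lambda>k. (t - s) * (?c k s + ?c k t) / 2 - (?S k t - ?S k s)) sums trapezoid_error f F s t"
    unfolding trapezoid_error_def f_def F_def
    by (intro sums_diff sums_divide sums_mult sums_add summable_sums summable_f summable_F)
  moreover have "(t - s) * (?c k s + ?c k t) / 2 - (?S k t - ?S k s) = trapezoid_term s t k" for k
  proof -
    have "(t - s) * (r * a + r * b) / 2 - (r * c - r * d) = r * ((t - s) * (a + b) / 2 - (c - d))"
      for r a b c d :: real
      by (simp add: field_simps)
    then have "(t - s) * (?c k s + ?c k t) / 2 - (?S k t - ?S k s) = \<theta> k / freq k *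
        trapezoid_error (\<lambda>x. cos (2 * pi * freq k * x)) (\<lambda>x. sin (2 * pi * freq k * x) / (2 * pi * freq k)) s t"
      unfolding trapezoid_error_def by this
    also have "\<dots> = trapezoid_term s t k"
      using freq_pos[of k] by (subst trapezoid_error_cos) (simp_all add: trapezoid_term_def power2_eq_square mult_ac)
    finally show ?thesis .
  qed
  ultimately show ?thesis by simp
qed

sublocale lipschitz_lift f F "2 * pi * suminf \<theta>"
proof
  fix s t
  show "\<bar>f t - f s\<bar> \<le> 2 * pi * suminf \<theta> * \<bar>t - s\<bar>"
  proof -
    let ?c = "\<lambda>k x. \<theta> k / freq k * cos (2 * pi * freq k * x)"
    have "\<bar>?c k t - ?c k s\<bar> \<le> (2 * pi * \<bar>t - s\<bar>) * \<theta> k" for k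
    proof -
      have "\<bar>?c k t - ?c k s\<bar> = \<theta> k / freq k * \<bar>cos (2 * pi * freq k * t) - cos (2 * pi * freq k * s)\<bar>"
        unfolding right_diff_distrib[symmetric] abs_mult using \<theta>_pos[of k] freq_pos[of k] by simp
      also have "\<dots> \<le> \<theta> k / freq k * \<bar>2 * pi * freq k * t - 2 * pi * freq k * s\<bar>"
        using \<theta>_pos[of k] freq_pos[of k] by (intro mult_left_mono cos_lipschitz) auto
      also have "\<dots> = (2 * pi * \<bar>t - s\<bar>) * \<theta> k"
        using freq_pos[of k] by (simp add: abs_mult flip: right_diff_distrib)
      finally show ?thesis .
    qed
    then have "\<bar>\<Sum>k. ?c k t - ?c k s\<bar> \<le> (2 * pi * \<bar>t - s\<bar>) * suminf \<theta>"
      by (rule suminf_abs_le)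
    also have "(\<Sum>k. ?c k t - ?c k s) = f t - f s"
      unfolding f_def by (intro suminf_diff[symmetric] summable_f)
    finally show ?thesis by (simp add: mult.commute mult.left_commute)
  qed
  show "\<bar>trapezoid_error f F s t\<bar> \<le> 2 * pi * suminf \<theta> * (t - s)\<^sup>2"
    using suminf_abs_le[OF trapezoid_term_le, of s t] trapezoid_error_sums[of s t]
    by (simp add: sums_iff mult_ac)
qed

text \<open>At scale \<open>1 / freq k\<close> a lower frequency is almost affine, so the trapezoid rule is almost
  exact (cubic bound), while a higher frequency has small amplitude (linear bound). Both
  gain the ratio of the frequencies, which beats the variation of the weights.\<close>

lemma trapezoid_term_off_diagonal_le:
  assumes jk: "j \<noteq> k" and h: "0 \<le> t - s" "t - s \<le> 1 / freq k"
  shows "\<bar>trapezoid_term s t j\<bar> \<le> 16 * \<theta> k / (freq k)\<^sup>2 * (1 / 10000) ^ ((j - k) + (k - j))"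
proof -
  define m where "m = (j - k) + (k - j)"
  define b where "b = 10000 * Q"
  define x where "x = b ^ m"
  have x: "0 < x" using Q_ge_1 by (simp add: x_def b_def)
  have pos: "0 < freq j" "0 < freq k" "0 < \<theta> j" by (simp_all add: freq_pos \<theta>_pos)
  note [simp] = pos pos[THEN less_imp_le] pos[THEN less_imp_neq, symmetric]
  have pi4: "pi < 4" by (rule pi_less_4)
  have bound: "\<bar>trapezoid_term s t j\<bar> \<le> \<theta> j / (pi * (freq j)\<^sup>2) * 1 * \<bar>trapezoid_symbol (pi * freq j * (t - s))\<bar>"
    unfolding trapezoid_term_def abs_mult[of "_ * _"] abs_mult[of "_ / _"] using pos
    by (intro mult_mono) auto
  have arg: "\<bar>pi * freq j * (t - s)\<bar> \<le> pi * freq j * (1 / freq k)"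
    unfolding abs_mult using h by (intro mult_mono) auto
  \<comment> \<open>The constant 16 serves both cases, which yield \<open>pi\<^sup>2\<close> and 2.\<close>
  have "\<bar>trapezoid_term s t j\<bar> \<le> 16 * \<theta> j / ((freq k)\<^sup>2 * x)"
  proof (cases "j < k")
    case True
    then have "k = j + m" by (simp add: m_def)
    then have fk: "freq k = freq j * x" by (simp add: freq_add x_def b_def)
    have "\<bar>trapezoid_symbol (pi * freq j * (t - s))\<bar> \<le> \<bar>pi * freq j * (t - s)\<bar> ^ 3" by (rule abs_trapezoid_symbol_le_cube)
    also have "\<dots> \<le> (pi * freq j * (1 / freq k)) ^ 3"
      by (intro power_mono arg) auto
    also have "\<dots> = (pi / x) ^ 3" by (simp add: fk)
    finally have "\<bar>trapezoid_term s t j\<bar> \<le> \<theta> j / (pi * (freq j)\<^sup>2) * 1 * (pi / x) ^ 3"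
      by (intro order_trans[OF bound] mult_left_mono) auto
    also have "\<dots> = pi\<^sup>2 * \<theta> j / ((freq k)\<^sup>2 * x)"
      using x by (simp add: fk field_simps power2_eq_square power3_eq_cube)
    also have "\<dots> \<le> 4\<^sup>2 * \<theta> j / ((freq k)\<^sup>2 * x)"
      using x pi4 by (intro divide_right_mono mult_right_mono power_mono) auto
    finally show ?thesis by simp
  next
    case False
    then have "j = k + m" using jk by (simp add: m_def)
    then have fj: "freq j = freq k * x" by (simp add: freq_add x_def b_def)
    have "\<bar>trapezoid_symbol (pi * freq j * (t - s))\<bar> \<le> 2 * \<bar>pi * freq j * (t - s)\<bar>" by (rule abs_trapezoid_symbol_le_2)
    also have "\<dots> \<le> 2 * (pi * freq j * (1 / freq k))"
      by (intro mult_left_mono arg) auto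
    also have "\<dots> = 2 * pi * x" by (simp add: fj)
    finally have "\<bar>trapezoid_term s t j\<bar> \<le> \<theta> j / (pi * (freq j)\<^sup>2) * 1 * (2 * pi * x)"
      by (intro order_trans[OF bound] mult_left_mono) auto
    also have "\<dots> = 2 * \<theta> j / ((freq k)\<^sup>2 * x)"
      using x by (simp add: fj field_simps power2_eq_square)
    also have "\<dots> \<le> 16 * \<theta> j / ((freq k)\<^sup>2 * x)"
      using x by (intro divide_right_mono mult_right_mono) auto
    finally show ?thesis .
  qed
  also have "\<dots> \<le> 16 * (\<theta> k * Q ^ m) / ((freq k)\<^sup>2 * x)"
    using \<theta>_le[of j k] x by (intro divide_right_mono mult_left_mono) (auto simp: m_def)
  also have "\<dots> = 16 * \<theta> k / (freq k)\<^sup>2 * (1 / 10000) ^ m"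
    using Q_ge_1 by (simp add: x_def b_def power_mult_distrib power_divide field_simps)
  finally show ?thesis by (simp add: m_def)
qed

text \<open>At scale \<open>1 / freq k\<close> the trapezoid error is that of the \<open>k\<close>-th cosine up to a small fraction of
  its maximal size.\<close>

lemma trapezoid_error_ge:
  assumes h: "1 / (2 * freq k) \<le> t - s" "t - s \<le> 1 / freq k"
  shows "\<theta> k / (pi * (freq k)\<^sup>2) * (\<bar>cos (pi * freq k * (s + t))\<bar> - 1 / 48) \<le> \<bar>trapezoid_error f F s t\<bar>"
proof -
  define D where "D = 16 * \<theta> k / (freq k)\<^sup>2"
  define e where "e j = (if j = k then 0 else (1 / 10000 :: real) ^ ((j - k) + (k - j)))" for j
  define rest where "rest j = (if j = k then 0 else trapezoid_term s t j)" for j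
  note pos = freq_pos[of k] \<theta>_pos[of k]
  note [simp] = pos pos[THEN less_imp_le] pos[THEN less_imp_neq, symmetric]
  have D: "0 < D" by (simp add: D_def)
  have h0: "0 \<le> t - s" using h(1) by (rule order_trans[rotated]) simp
  have e: "summable e" "suminf e \<le> 1 / 4000"
    using geometric_sum_off_diagonal_le[of "1 / 10000" k] by (simp_all add: e_def[abs_def])
  have "\<bar>rest j\<bar> \<le> D * e j" for j
    using trapezoid_term_off_diagonal_le[OF _ h0 h(2), of j] by (simp add: rest_def e_def D_def)
  then have "\<bar>suminf rest\<bar> \<le> (\<Sum>j. D * e j)"
    using norm_suminf_le[of rest "\<lambda>j. D * e j"] summable_mult[OF e(1)] by simp
  also have "\<dots> = D * suminf e" by (simp add: suminf_mult e)
  also have "\<dots> \<le> D * (1 / 4000)" using e D by (intro mult_left_mono) auto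
  also have "\<dots> \<le> \<theta> k / (pi * (freq k)\<^sup>2) * (1 / 48)"
    using pi_less_4 by (simp add: D_def field_simps)
  finally have rest: "\<bar>suminf rest\<bar> \<le> \<theta> k / (pi * (freq k)\<^sup>2) * (1 / 48)" .
  have "(\<lambda>j. trapezoid_term s t j - rest j) sums trapezoid_term s t k"
  proof -
    have "trapezoid_term s t j - rest j = (if j = k then trapezoid_term s t k else 0)" for j by (simp add: rest_def)
    then show ?thesis using sums_single[of k "\<lambda>_. trapezoid_term s t k"] by simp
  qed
  from sums_diff[OF trapezoid_error_sums[of s t] this]
  have split: "trapezoid_error f F s t = trapezoid_term s t k + suminf rest" by (simp add: sums_iff)
  have "pi * freq k * (1 / (2 * freq k)) \<le> pi * freq k * (t - s)"
    "pi * freq k * (t - s) \<le> pi * freq k * (1 / freq k)"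
    using h by (intro mult_left_mono; simp)+
  then have "pi / 2 \<le> pi * freq k * (t - s)" "pi * freq k * (t - s) \<le> pi" by simp_all
  then have "1 \<le> \<bar>trapezoid_symbol (pi * freq k * (t - s))\<bar>" by (rule abs_trapezoid_symbol_ge_1)
  then have "\<theta> k / (pi * (freq k)\<^sup>2) * \<bar>cos (pi * freq k * (s + t))\<bar> * 1 \<le> \<bar>trapezoid_term s t k\<bar>"
    unfolding trapezoid_term_def abs_mult[of "_ * _"] abs_mult[of "_ / _"]
    by (intro mult_mono) auto
  with rest split show ?thesis by (simp add: right_diff_distrib)
qed

end

section \<open>Divergence of the truncated integrals\<close>

context lacunary
begin

text \<open>At distance \<open>h\<close> about \<open>1 / freq k\<close> the height is, up to an oscillating factor, \<open>\<theta> k * h\<^sup>2\<close>, so the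
  kernel is of size \<open>\<theta> k powr (\<alpha> / 2) / h\<close>. Here \<open>\<alpha> < 2\<close> gives \<open>y \<le> y powr (\<alpha> / 2)\<close> for
  \<open>y \<in> {0..1}\<close>, which replaces the power of the oscillating factor by the factor itself.\<close>

lemma heis_kernel_lift_ge:
  assumes \<alpha>: "0 < \<alpha>" "\<alpha> < 2"
    and h: "1 / (2 * freq k) \<le> t - s" "t - s \<le> 1 / freq k"
  shows "(\<theta> k / pi) powr (\<alpha> / 2) / L powr (\<alpha> + 1) *
      (freq k * ((cos (pi * freq k * (s + t)))\<^sup>2 - 1 / 48)) \<le> heis_kernel \<alpha> (- \<gamma> s + \<gamma> t)"
proof -
  define n where "n = freq k"
  define C where "C = cos (pi * n * (s + t))"
  define y where "y = C\<^sup>2 - 1 / 48"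
  define A where "A = trapezoid_error f F s t"
  define d where "d = dist (\<gamma> t) (\<gamma> s)"
  have n: "0 < n" unfolding n_def by (rule freq_pos)
  have h0: "0 < t - s" using h(1) n by (intro less_le_trans[OF _ h(1)]) (simp add: n_def)
  have d: "0 < d" "d \<le> L / n"
  proof -
    show "0 < d" using dist_lift_ge[of t s] h0 unfolding d_def by linarith
    have "d \<le> L * (t - s)" using dist_lift_le[of t s] h0 by (simp add: d_def)
    also have "\<dots> \<le> L * (1 / n)" using h(2) L_ge_1 by (intro mult_left_mono) (auto simp: n_def)
    finally show "d \<le> L / n" by simp
  qed
  have K: "heis_kernel \<alpha> (- \<gamma> s + \<gamma> t) = \<bar>A\<bar> powr (\<alpha> / 2) / d powr (\<alpha> + 1)"
    by (simp add: heis_kernel_def d_def dist_heis_def A_def) (simp add: horizontal_lift_difference)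
  show ?thesis
  proof (cases "0 \<le> y")
    case False
    then have "(\<theta> k / pi) powr (\<alpha> / 2) / L powr (\<alpha> + 1) * (n * y) \<le> 0"
      using n by (intro mult_nonneg_nonpos) (auto simp: mult_le_0_iff)
    then show ?thesis using heis_kernel_nonneg[of \<alpha> "- \<gamma> s + \<gamma> t"] by (simp add: y_def C_def n_def)
  next
    case True
    have C1: "\<bar>C\<bar> \<le> 1" by (simp add: C_def)
    then have "C\<^sup>2 \<le> \<bar>C\<bar>"
      using mult_left_mono[of "\<bar>C\<bar>" 1 "\<bar>C\<bar>"] by (simp add: power2_eq_square flip: abs_mult)
    then have yC: "y \<le> \<bar>C\<bar> - 1 / 48" "y \<le> 1" using C1 by (auto simp: y_def)
    have y_powr: "y \<le> y powr (\<alpha> / 2)"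
    proof (cases "y = 0")
      case False
      then have "y powr 1 \<le> y powr (\<alpha> / 2)"
        using True yC \<alpha> by (intro powr_mono') auto
      then show ?thesis using True by simp
    qed simp
    have "\<theta> k / pi / n\<^sup>2 * y = \<theta> k / (pi * n\<^sup>2) * y" by simp
    also have "\<dots> \<le> \<theta> k / (pi * n\<^sup>2) * (\<bar>C\<bar> - 1 / 48)"
      using yC(1) \<theta>_pos[of k] by (intro mult_left_mono) (auto simp: less_imp_le)
    also have "\<dots> \<le> \<bar>A\<bar>"
      unfolding A_def C_def n_def using h by (rule trapezoid_error_ge)
    finally have "(\<theta> k / pi / n\<^sup>2 * y) powr (\<alpha> / 2) \<le> \<bar>A\<bar> powr (\<alpha> / 2)"
      using \<theta>_pos[of k] True \<alpha> by (intro powr_mono2) auto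
    moreover have "(\<theta> k / pi / n\<^sup>2 * y) powr (\<alpha> / 2) = (\<theta> k / pi) powr (\<alpha> / 2) / n powr \<alpha> * y powr (\<alpha> / 2)"
    proof -
      have "n\<^sup>2 powr (\<alpha> / 2) = n powr \<alpha>"
        using n powr_powr[of n 2 "\<alpha> / 2"] by simp
      then show ?thesis
        using \<theta>_pos[of k] True n by (simp add: powr_mult powr_divide)
    qed
    moreover have "(\<theta> k / pi) powr (\<alpha> / 2) / n powr \<alpha> * y
        \<le> (\<theta> k / pi) powr (\<alpha> / 2) / n powr \<alpha> * y powr (\<alpha> / 2)"
      using y_powr by (intro mult_left_mono) auto
    ultimately have A: "(\<theta> k / pi) powr (\<alpha> / 2) / n powr \<alpha> * y \<le> \<bar>A\<bar> powr (\<alpha> / 2)"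
      by simp
    have "(\<theta> k / pi) powr (\<alpha> / 2) / L powr (\<alpha> + 1) * (n * y)
        = (\<theta> k / pi) powr (\<alpha> / 2) / n powr \<alpha> * y / (L / n) powr (\<alpha> + 1)"
      using n L_ge_1 by (simp add: powr_divide powr_add field_simps)
    also have "\<dots> \<le> \<bar>A\<bar> powr (\<alpha> / 2) / d powr (\<alpha> + 1)"
      using A d \<alpha> True n by (intro frac_le powr_mono2) auto
    finally show ?thesis unfolding K by (simp add: y_def C_def n_def)
  qed
qed

lemma nn_integral_heis_kernel_lift_ge:
  assumes \<alpha>: "0 < \<alpha>" "\<alpha> < 2"
  shows "ennreal ((\<theta> k / pi) powr (\<alpha> / 2) / L powr (\<alpha> + 1) / 16) \<le>
    (\<integral>\<^sup>+t. ennreal (heis_kernel \<alpha> (- \<gamma> s + \<gamma> t)) * indicator {s + 1 / (2 * freq k)..s + 1 / freq k} t \<partial>lborel)"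
proof -
  let ?I = "{s + 1 / (2 * freq k)..s + 1 / freq k}"
  define c where "c = (\<theta> k / pi) powr (\<alpha> / 2) / L powr (\<alpha> + 1)"
  have c: "0 \<le> c" by (simp add: c_def)
  have "ennreal (c / 16) = ennreal c * ennreal (1 / 16)"
    using c by (simp flip: ennreal_mult)
  also have "\<dots> \<le> ennreal c * (\<integral>\<^sup>+t. ennreal (freq k * ((cos (pi * freq k * (s + t)))\<^sup>2 - 1 / 48)) * indicator ?I t \<partial>lborel)"
    by (intro mult_left_mono nn_integral_cos_square_excess freq_pos) simp
  also have "\<dots> = (\<integral>\<^sup>+t. ennreal c * (ennreal (freq k * ((cos (pi * freq k * (s + t)))\<^sup>2 - 1 / 48)) * indicator ?I t) \<partial>lborel)"
    by (rule nn_integral_cmult[symmetric]) measurable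
  also have "\<dots> \<le> (\<integral>\<^sup>+t. ennreal (heis_kernel \<alpha> (- \<gamma> s + \<gamma> t)) * indicator ?I t \<partial>lborel)"
  proof (intro nn_integral_mono)
    fix t
    show "ennreal c * (ennreal (freq k * ((cos (pi * freq k * (s + t)))\<^sup>2 - 1 / 48)) * indicator ?I t)
        \<le> ennreal (heis_kernel \<alpha> (- \<gamma> s + \<gamma> t)) * indicator ?I t"
    proof (cases "t \<in> ?I")
      case True
      then have "1 / (2 * freq k) \<le> t - s" "t - s \<le> 1 / freq k" by auto
      from heis_kernel_lift_ge[OF \<alpha> this] show ?thesis
        using True c by (simp add: c_def[symmetric] ennreal_leI flip: ennreal_mult')
    qed simp
  qed
  finally show ?thesis by (simp add: c_def)
qed

text \<open>Each scale contributes at least a constant times \<open>\<theta> k powr (\<alpha> / 2)\<close>, from an interval of its own.\<close>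

lemma not_SIO_bounded_L2:
  assumes \<alpha>: "0 < \<alpha>" "\<alpha> < 2" and div: "\<not> summable (\<lambda>k. \<theta> k powr (\<alpha> / 2))"
  shows "\<not> SIO_bounded_L2 (heis_kernel \<alpha>) E"
proof (rule not_SIO_bounded_L2_if_diverges[OF \<alpha>(1)])
  fix M :: real
  define c where "c = 1 / (pi powr (\<alpha> / 2) * L powr (\<alpha> + 1) * 16)"
  have c: "0 < c" using L_ge_1 by (simp add: c_def)
  obtain N where N: "M / c < (\<Sum>k<N. \<theta> k powr (\<alpha> / 2))"
  proof -
    have "\<not> (\<forall>N. (\<Sum>k<N. \<theta> k powr (\<alpha> / 2)) \<le> M / c)"
      using div by (metis bounded_imp_summable powr_ge_zero lessThan_Suc_atMost)
    then show ?thesis using that by (auto simp: not_le)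
  qed
  define J where "J s k = {s + 1 / (2 * freq k)..s + 1 / freq k}" for s k
  have decay: "1 / freq m < 1 / (2 * freq k)" if "k < m" for k m
  proof -
    have "10000 * 1 \<le> 10000 * Q" using Q_ge_1 by simp
    also have "10000 * Q \<le> (10000 * Q) ^ (m - k)"
      using that Q_ge_1 by (intro self_le_power) auto
    finally have "10000 * freq k \<le> (10000 * Q) ^ (m - k) * freq k"
      using freq_pos[of k] by (intro mult_right_mono) auto
    also have "\<dots> = freq m" using that freq_add[of k "m - k"] by (simp add: mult.commute)
    finally show ?thesis
      using freq_pos[of k] freq_pos[of m] by (intro divide_strict_left_mono) auto
  qed
  show "\<exists>\<epsilon>>0. \<forall>s\<in>{0..1}. ennreal M \<le>
    (\<integral>\<^sup>+x. ennreal (heis_kernel \<alpha> (- \<gamma> s + \<gamma> x)) * indicator {s + \<epsilon>..s + 1} x \<partial>lborel)"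
  proof (intro exI[of _ "1 / (2 * freq N)"] conjI ballI)
    fix s :: real
    have J_disj: "disjoint_family_on (J s) {..<N}"
    proof -
      have "J s k \<inter> J s m = {}" if "k < m" for k m
        using decay[OF that] by (auto simp: J_def)
      then show ?thesis
        unfolding disjoint_family_on_def by (metis linorder_neqE_nat inf_commute)
    qed
    have J_sub: "(\<Union>k<N. J s k) \<subseteq> {s + 1 / (2 * freq N)..s + 1}"
    proof -
      have "1 / (2 * freq N) \<le> 1 / (2 * freq k)" "1 / freq k \<le> 1" if "k < N" for k
      proof -
        have "1 / (2 * freq N) \<le> 1 / freq N"
          using freq_pos[of N] by (intro divide_left_mono) auto
        then show "1 / (2 * freq N) \<le> 1 / (2 * freq k)" using decay[OF that] by linarith
        show "1 / freq k \<le> 1" using freq_ge_1[of k] by simp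
      qed
      then show ?thesis by (fastforce simp: J_def)
    qed
    have [measurable]: "J s k \<in> sets borel" for k by (simp add: J_def)
    have [measurable]: "(\<lambda>x. heis_kernel \<alpha> (- \<gamma> s + \<gamma> x)) \<in> borel_measurable borel"
      by (rule measurable_compose[OF measurable_lift measurable_heis_kernel_translate])
    have "ennreal M \<le> ennreal (\<Sum>k<N. c * \<theta> k powr (\<alpha> / 2))"
      using N c by (intro ennreal_leI) (simp add: field_simps flip: sum_distrib_left)
    also have "\<dots> = (\<Sum>k<N. ennreal (c * \<theta> k powr (\<alpha> / 2)))"
      using c by (intro sum_ennreal[symmetric]) auto
    also have "\<dots> \<le> (\<Sum>k<N. \<integral>\<^sup>+x. ennreal (heis_kernel \<alpha> (- \<gamma> s + \<gamma> x)) * indicator (J s k) x \<partial>lborel)"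
    proof (rule sum_mono)
      fix k
      have "c * \<theta> k powr (\<alpha> / 2) = (\<theta> k / pi) powr (\<alpha> / 2) / L powr (\<alpha> + 1) / 16"
        using \<theta>_pos[of k] by (simp add: c_def powr_divide)
      then show "ennreal (c * \<theta> k powr (\<alpha> / 2)) \<le>
          (\<integral>\<^sup>+x. ennreal (heis_kernel \<alpha> (- \<gamma> s + \<gamma> x)) * indicator (J s k) x \<partial>lborel)"
        unfolding J_def using nn_integral_heis_kernel_lift_ge[OF \<alpha>] by simp
    qed
    also have "\<dots> = (\<integral>\<^sup>+x. (\<Sum>k<N. ennreal (heis_kernel \<alpha> (- \<gamma> s + \<gamma> x)) * indicator (J s k) x) \<partial>lborel)"
      by (rule nn_integral_sum[symmetric]) measurable
    also have "\<dots> = (\<integral>\<^sup>+x. ennreal (heis_kernel \<alpha> (- \<gamma> s + \<gamma> x)) * indicator (\<Union>k<N. J s k) x \<partial>lborel)"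
      using J_disj by (simp add: indicator_UN_disjoint sum_distrib_left)
    also have "\<dots> \<le> (\<integral>\<^sup>+x. ennreal (heis_kernel \<alpha> (- \<gamma> s + \<gamma> x)) * indicator {s + 1 / (2 * freq N)..s + 1} x \<partial>lborel)"
      using J_sub by (intro nn_integral_mono mult_left_mono) (auto split: split_indicator)
    finally show "ennreal M \<le> (\<integral>\<^sup>+x. ennreal (heis_kernel \<alpha> (- \<gamma> s + \<gamma> x))
      * indicator {s + 1 / (2 * freq N)..s + 1} x \<partial>lborel)" .
  qed (simp add: freq_pos)
qed

end

text \<open>The growth condition with \<open>Q = 2 powr s\<close> reduces to \<open>Suc k \<le> Suc j * Suc \<bar>j - k\<bar>\<close> and \<open>Suc m \<le> 2 ^ m\<close>.\<close>

lemma lacunary_powr: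
  assumes s: "1 < s"
  shows "lacunary (\<lambda>k. real (Suc k) powr (- s)) (2 powr s)"
proof
  show "summable (\<lambda>k. real (Suc k) powr (- s))"
    using s by (intro iffD2[OF summable_Suc_iff[of "\<lambda>k. real k powr (- s)"]])
      (simp add: summable_real_powr_iff)
  fix j k :: nat
  define m where "m = (j - k) + (k - j)"
  have "real (Suc k) \<le> real (Suc j) * 2 ^ m"
  proof -
    have "Suc m \<le> 2 ^ m" by (rule Suc_leI) (rule less_exp)
    then have "Suc j * Suc m \<le> Suc j * 2 ^ m" by (rule mult_le_mono2)
    moreover have "Suc k \<le> Suc j * Suc m" by (simp add: m_def)
    ultimately have "Suc k \<le> Suc j * 2 ^ m" by (rule order_trans[rotated])
    then have "real (Suc k) \<le> real (Suc j * 2 ^ m)" by (rule of_nat_mono)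
    then show ?thesis by (simp only: of_nat_mult of_nat_power of_nat_numeral)
  qed
  then have "(real (Suc j) * 2 ^ m) powr (- s) \<le> real (Suc k) powr (- s)"
    using s by (intro powr_mono2') auto
  moreover have "(real (Suc j) * 2 ^ m) powr (- s) = real (Suc j) powr (- s) / (2 powr s) ^ m"
    by (simp add: powr_mult powr_minus divide_inverse powr_power powr_powr flip: powr_realpow)
      (simp add: mult.commute)
  ultimately show "real (Suc j) powr (- s) \<le> real (Suc k) powr (- s) * (2 powr s) ^ ((j - k) + (k - j))"
    by (simp add: m_def[symmetric] divide_le_eq)
qed simp

theorem theorem1p5:
  fixes \<alpha> :: real
  assumes "0 < \<alpha>" and "\<alpha> < 2"
  shows "\<exists>E :: heis set. ahlfors_regular1_curve E \<and> \<not> SIO_bounded_L2 (heis_kernel \<alpha>) E"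
proof -
  \<comment> \<open>With this exponent, the series of \<open>\<theta> k powr (\<alpha> / 2)\<close> is harmonic, while \<open>\<theta>\<close> is summable because
    \<open>2 / \<alpha> > 1\<close>.\<close>
  interpret lacunary "\<lambda>k. real (Suc k) powr (- (2 / \<alpha>))" "2 powr (2 / \<alpha>)"
    using assms by (intro lacunary_powr) simp
  have "\<not> summable (\<lambda>k. (real (Suc k) powr (- (2 / \<alpha>))) powr (\<alpha> / 2))"
  proof -
    have "(real (Suc k) powr (- (2 / \<alpha>))) powr (\<alpha> / 2) = real (Suc k) powr (- 1)" for k
      using assms by (simp add: powr_powr)
    moreover have "\<not> summable (\<lambda>k. real (Suc k) powr (- 1))"
      unfolding summable_Suc_iff[of "\<lambda>k. real k powr (- 1)"] summable_real_powr_iff by simp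
    ultimately show ?thesis by simp
  qed
  then show ?thesis
    using ahlfors_regular_curve not_SIO_bounded_L2[OF assms] by blast
qed

end
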